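(* Let $L$ be a finite-dimensional restricted Lie algebra over an algebraically closed field of characteristic $p>0$, $p\neq 2$, in which every restricted subalgebra of $L$ is a restricted quasi-ideal of $L$. Then $L$ has a Cartan subalgebra $H$ such that $H=S\oplus P$, where $S$ is a torus and $P$ is the set of $p$-nilpotent elements in $H$, and $L=S\dot{+}N$, where $N$ is an ideal of $L$, $N^3=0$ and $N^{[p]}\subseteq Z(H)$.
   Context: All algebras are finite-dimensional. A restricted subalgebra $S$ of a restricted Lie algebra $L$ is a restricted quasi-ideal of $L$ if $[S,H]\subseteq S+H$ for all restricted subalgebras $H$ of $L$. For a subset $X$ of $L$, $\langle X\rangle_p$ denotes the restricted subalgebra generated by $X$. An element $x$ is semisimple if $x\in\langle x^{[p]}\rangle_p$; a torus is an abelian restricted Lie algebra consisting of semisimple elements. An element $x$ is $p$-nilpotent if $x^{[p]^n}=0$ for some $n>0$. $N^{[p]}$ denotes the restricted subalgebra generated by all elements $x^{[p]}$ with $x\in N$. The lower central series is $N^1=N$, $N^{k+1}=[N^k,N]$. $Z(H)$ is the centre of $H$. $\oplus$ denotes algebra direct sum and $\dot{+}$ vector space direct sum. *)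

theory Defs
  imports
    "HOL-Computational_Algebra.Polynomial"
    "HOL-Library.Set_Algebras"
begin

locale lie_algebra = vector_space scale
  for scale :: "'k::field \<Rightarrow> 'a::ab_group_add \<Rightarrow> 'a"
  + fixes bracket :: "'a \<Rightarrow> 'a \<Rightarrow> 'a"
  assumes linear_right: "Vector_Spaces.linear scale scale (\<lambda>y. bracket x y)"
    and linear_left: "Vector_Spaces.linear scale scale (\<lambda>x. bracket x y)"
    and alternating: "bracket x x = 0"
    and jacobi: "bracket x (bracket y z) + bracket y (bracket z x) + bracket z (bracket x y) = 0"
begin

definition brackets :: "'a set \<Rightarrow> 'a set \<Rightarrow> 'a set" where
  "brackets A B = span {bracket a b | a b. a \<in> A \<and> b \<in> B}"

definition subalgebra :: "'a set \<Rightarrow> bool" where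
  "subalgebra S \<longleftrightarrow> subspace S \<and> (\<forall>x\<in>S. \<forall>y\<in>S. bracket x y \<in> S)"

definition ideal_of :: "'a set \<Rightarrow> 'a set \<Rightarrow> bool" where
  "ideal_of I M \<longleftrightarrow> subspace I \<and> I \<subseteq> M \<and> (\<forall>x\<in>I. \<forall>y\<in>M. bracket x y \<in> I)"

definition centre :: "'a set \<Rightarrow> 'a set" where
  "centre M = {z \<in> M. \<forall>x\<in>M. bracket z x = 0}"

definition normalizer :: "'a set \<Rightarrow> 'a set" where
  "normalizer M = {x. \<forall>y\<in>M. bracket x y \<in> M}"

text \<open>The lower central series is indexed from \<open>1\<close>: \<open>lower_central M 1 = M\<close>
  (and \<open>lower_central M 0 = M\<close> as well), so \<open>lower_central M 3 = [[M, M], M]\<close>.\<close>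
definition lower_central :: "'a set \<Rightarrow> nat \<Rightarrow> 'a set" where
  "lower_central M k = ((\<lambda>A. brackets A M) ^^ (k - 1)) M"

definition nilpotent :: "'a set \<Rightarrow> bool" where
  "nilpotent M \<longleftrightarrow> (\<exists>k. lower_central M k = {0})"

definition cartan_subalgebra :: "'a set \<Rightarrow> bool" where
  "cartan_subalgebra H \<longleftrightarrow> subalgebra H \<and> nilpotent H \<and> normalizer H = H"

definition vector_direct_sum :: "'a set \<Rightarrow> 'a set \<Rightarrow> 'a set \<Rightarrow> bool" where
  "vector_direct_sum M A B \<longleftrightarrow> subspace A \<and> subspace B \<and> A \<inter> B = {0} \<and> M = A + B"

definition algebra_direct_sum :: "'a set \<Rightarrow> 'a set \<Rightarrow> 'a set \<Rightarrow> bool" where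
  "algebra_direct_sum M A B \<longleftrightarrow> vector_direct_sum M A B \<and> ideal_of A M \<and> ideal_of B M"

text \<open>Elements of \<open>L \<otimes> k[t]\<close> are represented as polynomials in \<open>t\<close> with coefficients in \<open>L\<close>;
  \<open>ad_pencil x y\<close> is \<open>ad (tx + y)\<close> acting on them.\<close>
definition ad_pencil :: "'a \<Rightarrow> 'a \<Rightarrow> 'a poly \<Rightarrow> 'a poly" where
  "ad_pencil x y q = pCons 0 (map_poly (bracket x) q) + map_poly (bracket y) q"

text \<open>Jacobson's \<open>s\<^sub>i\<close>, given by \<open>(ad (tx + y))\<^sup>p\<^sup>-\<^sup>1 x = (\<Sum>i = 1..p - 1. i s\<^sub>i(x, y) t\<^sup>i\<^sup>-\<^sup>1)\<close>.\<close>
definition jacobson_term :: "nat \<Rightarrow> nat \<Rightarrow> 'a \<Rightarrow> 'a \<Rightarrow> 'a" where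
  "jacobson_term p i x y =
     scale (inverse (of_nat i)) (coeff ((ad_pencil x y ^^ (p - 1)) [:x:]) (i - 1))"

end

locale restricted_lie_algebra = lie_algebra scale bracket
  for scale :: "'k::field \<Rightarrow> 'a::ab_group_add \<Rightarrow> 'a" and bracket :: "'a \<Rightarrow> 'a \<Rightarrow> 'a"
  + fixes pmap :: "'a \<Rightarrow> 'a"
  assumes char_pos: "CHAR('k) > 0"
    and bracket_pmap: "bracket (pmap x) y = (bracket x ^^ CHAR('k)) y"
    and pmap_scale: "pmap (scale c x) = scale (c ^ CHAR('k)) (pmap x)"
    and pmap_add: "pmap (x + y) =
      pmap x + pmap y + (\<Sum>i = 1..CHAR('k) - 1. jacobson_term CHAR('k) i x y)"
begin

definition restricted_subalgebra :: "'a set \<Rightarrow> bool" where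
  "restricted_subalgebra S \<longleftrightarrow> subalgebra S \<and> (\<forall>x\<in>S. pmap x \<in> S)"

definition generated :: "'a set \<Rightarrow> 'a set" where
  "generated X = restricted_subalgebra hull X"

definition restricted_quasi_ideal :: "'a set \<Rightarrow> bool" where
  "restricted_quasi_ideal S \<longleftrightarrow> restricted_subalgebra S \<and>
     (\<forall>H. restricted_subalgebra H \<longrightarrow> brackets S H \<subseteq> S + H)"

definition semisimple :: "'a \<Rightarrow> bool" where
  "semisimple x \<longleftrightarrow> x \<in> generated {pmap x}"

definition torus :: "'a set \<Rightarrow> bool" where
  "torus S \<longleftrightarrow> restricted_subalgebra S \<and> (\<forall>x\<in>S. \<forall>y\<in>S. bracket x y = 0) \<and> (\<forall>x\<in>S. semisimple x)"

definition p_nilpotent :: "'a \<Rightarrow> bool" where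
  "p_nilpotent x \<longleftrightarrow> (\<exists>n>0. (pmap ^^ n) x = 0)"

definition p_power :: "'a set \<Rightarrow> 'a set" where
  "p_power N = generated (pmap ` N)"

end

end

theory Submission
  imports Defs "HOL-Computational_Algebra.Primes"
begin

text \<open>
  Write \<open>F\<close> for the \<open>p\<close>-map and \<open>\<langle>x\<rangle>\<close> for the span of all \<open>F\<^sup>i x\<close>; the hypothesis gives
  \<open>[x, y] \<in> \<langle>x\<rangle> + \<langle>y\<rangle>\<close> for all \<open>x\<close> and \<open>y\<close>.

  Suppose that every \<open>ad x\<close> is nilpotent. Then even \<open>[x, y] \<in> \<langle>F x\<rangle> + \<langle>F y\<rangle>\<close>. An element \<open>x\<close> of the
  third term of the upper central series commutes with every \<open>F y\<close>, because \<open>p \<ge> 3\<close>, and this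
  forces \<open>2[w, [x, y]] = 0\<close>, so \<open>x\<close> already lies in the second term. Hence \<open>L\<^sup>3 = 0\<close>, the map \<open>F\<close> is
  semilinear with central values, and its Fitting decomposition is \<open>L = S \<oplus> P\<close>, with \<open>H = L\<close> and
  \<open>N = P\<close>.

  Otherwise \<open>[x, y] = y\<close> for some \<open>x\<close> and some \<open>y \<noteq> 0\<close>. Solving an Artin-Schreier equation in \<open>\<langle>x\<rangle>\<close>
  one may take \<open>x = t\<close> with \<open>F t = t\<close>, so that \<open>\<langle>t\<rangle>\<close> is a line. Comparing \<open>t\<close> with the toral elements
  near \<open>t + y\<close> gives \<open>F y = 0\<close>. By sums of weight vectors, \<open>1\<close> is the only nonzero weight of \<open>t\<close> and
  \<open>F\<close> has no zeros on the centralizer of \<open>t\<close> except \<open>0\<close>. So this centralizer is a torus; it serves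
  as \<open>H = S\<close>, with \<open>P = 0\<close>, and \<open>N\<close> is the abelian weight space of weight \<open>1\<close>.
\<close>

subsection \<open>Linear algebra\<close>

text \<open>The value of \<open>q(D)\<close> at \<open>v\<close>. Each recursion step moves one
  \<open>D\<close> onto the argument, so the \<open>pCons\<close> rule holds for any map
  \<open>D\<close>, linear or not.\<close>

definition poly_act :: "('a::zero \<Rightarrow> 'b \<Rightarrow> 'b) \<Rightarrow> ('b \<Rightarrow> 'b) \<Rightarrow> 'a poly \<Rightarrow> 'b::ab_group_add \<Rightarrow> 'b" where
  "poly_act scale D q = fold_coeffs (\<lambda>c h v. scale c v + h (D v)) q (\<lambda>_. 0)"

context vector_space
begin

lemma subset_plus_left: "subspace B \<Longrightarrow> A \<subseteq> A + B"
  using set_zero_plus2[of B A] by (simp add: subspace_0 add.commute)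

lemma subset_plus_right: "subspace A \<Longrightarrow> B \<subseteq> A + B"
  using set_zero_plus2[of A B] by (simp add: subspace_0)

lemma poly_act_0 [simp]: "poly_act scale D 0 v = 0"
  by (simp add: poly_act_def)

lemma poly_act_pCons [simp]: "poly_act scale D (pCons c q) v = scale c v + poly_act scale D q (D v)"
  by (cases "c = 0"; cases "q = 0") (auto simp: poly_act_def)

lemma poly_act_add: "poly_act scale D (q + r) v = poly_act scale D q v + poly_act scale D r v"
  by (induction q r arbitrary: v rule: poly_induct2) (auto simp: scale_left_distrib algebra_simps)

lemma poly_act_smult: "poly_act scale D (smult c q) v = scale c (poly_act scale D q v)"
  by (induction q arbitrary: v) (auto simp: scale_right_distrib)

context
  fixes D :: "'b \<Rightarrow> 'b"
  assumes D: "module_hom scale scale D"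
begin

interpretation D: module_hom scale scale D by (rule D)

lemma poly_act_arg:
  "poly_act scale D q (u + v) = poly_act scale D q u + poly_act scale D q v"
  "poly_act scale D q (scale c u) = scale c (poly_act scale D q u)"
  by (induction q arbitrary: u v) 
    (auto simp: D.add D.scale scale_right_distrib scale_left_commute algebra_simps)

text \<open>Split off a root \<open>c\<close> of \<open>q\<close>: either \<open>v\<close> is an
  eigenvector, or \<open>D v - c v\<close> is a nonzero vector killed by the cofactor, which has
  smaller degree. Knowing that the eigenvalue is a root of \<open>q\<close> is what later excludes
  unwanted eigenvalues.\<close>

lemma eigenvector_of_annihilator:
  fixes q :: "'a poly"
  assumes "q \<noteq> 0" "poly_act scale D q v = 0" "v \<noteq> 0" "v \<in> U" "subspace U" "D ` U \<subseteq> U"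
    and roots: "\<And>r::'a poly. r dvd q \<Longrightarrow> degree r > 0 \<Longrightarrow> \<exists>x. poly r x = 0"
  shows "\<exists>c w. poly q c = 0 \<and> w \<in> U \<and> w \<noteq> 0 \<and> D w = scale c w"
  using assms(1-4) roots
proof (induction "degree q" arbitrary: q v)
  case 0
  then obtain c where "q = [:c:]" by (metis degree_eq_zeroE)
  with 0 show ?case by auto
next
  case (Suc n)
  then obtain c where c: "poly q c = 0" by (metis dvd_refl zero_less_Suc)
  then obtain r where r: "q = [:-c, 1:] * r" by (auto simp: poly_eq_0_iff_dvd)
  have r0: "r \<noteq> 0" using r Suc.prems by auto
  have "degree q = Suc (degree r)" using r0 by (simp add: r degree_mult_eq del: mult_pCons_left)
  then have n: "n = degree r" using Suc by simp
  have act: "poly_act scale D r (D v - scale c v) = 0"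
  proof -
    have "q = smult (- c) r + pCons 0 r" by (simp add: r)
    then have "poly_act scale D q v = poly_act scale D r (scale (- c) v + D v)"
      by (simp only: poly_act_add poly_act_smult poly_act_pCons poly_act_arg) simp
    then show ?thesis using Suc.prems(2) by (simp add: add.commute)
  qed
  show ?case
  proof (cases "D v = scale c v")
    case True
    then show ?thesis using c Suc.prems by blast
  next
    case False
    have "D v - scale c v \<in> U"
      using Suc.prems(4) assms(5,6) by (auto intro!: subspace_diff subspace_scale)
    then have "\<exists>c w. poly r c = 0 \<and> w \<in> U \<and> w \<noteq> 0 \<and> D w = scale c w"
      using Suc.hyps(1)[OF n r0 act] False Suc.prems(5) r by (metis dvd_mult right_minus_eq)
    then show ?thesis using r by auto
  qed
qed

end

end

lemma (in vector_space) in_span_lessThanE: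
  assumes "v \<in> span (g ` {..<m::nat})"
  obtains a where "v = (\<Sum>i<m. scale (a i) (g i))"
  using assms
proof (induction m arbitrary: v thesis)
  case (Suc m)
  then obtain k where "v - scale k (g m) \<in> span (g ` {..<m})"
    by (auto simp: lessThan_Suc span_breakdown_eq)
  then obtain a where a: "v - scale k (g m) = (\<Sum>i<m. scale (a i) (g i))"
    using Suc.IH by blast
  have "v = (\<Sum>i<Suc m. scale ((a(m := k)) i) (g i))"
    using a by (simp add: algebra_simps)
  then show ?case using Suc.prems by blast
qed simp

section \<open>Chains of subspaces in finite dimension\<close>

context finite_dimensional_vector_space
begin

lemma descending_stable:
  assumes "\<And>n. subspace (U n)" "\<And>n. U (Suc n) \<subseteq> U n"
  shows "\<exists>n. \<forall>m\<ge>n. U m = U n"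
proof -
  obtain n where n: "\<And>m. dim (U n) \<le> dim (U m)"
    using ex_has_least_nat[of "\<lambda>_. True" 0 "\<lambda>n. dim (U n)"] by auto
  have "U m = U n" if "n \<le> m" for m
    using assms n lift_Suc_antimono_le[of U, OF assms(2) that] by (intro subspace_dim_equal) auto
  then show ?thesis by blast
qed

lemma ascending_stable:
  assumes "\<And>n. subspace (U n)" "\<And>n. U n \<subseteq> U (Suc n)"
  shows "\<exists>n. \<forall>m\<ge>n. U m = U n"
proof -
  obtain n where n: "\<And>m. dim (U m) \<le> dim (U n)"
    using ex_has_greatest_nat[of "\<lambda>_. True" 0 "\<lambda>n. dim (U n)" "Suc dimension"] dim_subset_UNIV
    by (auto simp: less_Suc_eq_le)
  have "U n = U m" if "n \<le> m" for m
    using assms n lift_Suc_mono_le[of U, OF assms(2) that] by (intro subspace_dim_equal) auto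
  then show ?thesis by blast
qed

text \<open>The spans of the tails descend, hence stabilise. For the iterates of a linear map on a
  vector this gives a polynomial relation with lowest coefficient 1.\<close>

lemma in_span_of_later: "\<exists>m. g m \<in> span (g ` {m<..})" for g :: "nat \<Rightarrow> 'b"
proof -
  have "\<exists>n. \<forall>m\<ge>n. span (g ` {m..}) = span (g ` {n..})"
    by (rule descending_stable) (auto intro!: span_mono)
  then obtain n where "\<forall>m\<ge>n. span (g ` {m..}) = span (g ` {n..})" ..
  then have "span (g ` {n..}) = span (g ` {n<..})"
    by (metis Suc_n_not_le_n atLeast_Suc_greaterThan le_SucI order_refl)
  then show ?thesis by (metis atLeast_iff imageI order_refl span_base)
qed

lemma in_span_of_earlier: "\<exists>m. g m \<in> span (g ` {..<m})" for g :: "nat \<Rightarrow> 'b"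
proof -
  have "\<exists>n. \<forall>m\<ge>n. span (g ` {..<m}) = span (g ` {..<n})"
    by (rule ascending_stable) (auto intro!: span_mono)
  then obtain n where "\<forall>m\<ge>n. span (g ` {..<m}) = span (g ` {..<n})" ..
  then have "span (g ` {..<Suc n}) = span (g ` {..<n})" by (metis le_SucI order_refl)
  then show ?thesis by (metis lessThan_iff imageI lessI span_base)
qed

end

subsection \<open>Lie algebras\<close>

context lie_algebra
begin

lemma bracket_add_right: "bracket x (y + z) = bracket x y + bracket x z"
  using linear_right[of x] by (simp add: Vector_Spaces.linear_iff)

lemma bracket_add_left: "bracket (x + y) z = bracket x z + bracket y z"
  using linear_left[of z] by (simp add: Vector_Spaces.linear_iff)

lemma bracket_scale_right: "bracket x (scale c y) = scale c (bracket x y)"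
  using linear_right[of x] by (simp add: Vector_Spaces.linear_iff)

lemma bracket_scale_left: "bracket (scale c x) y = scale c (bracket x y)"
  using linear_left[of y] by (simp add: Vector_Spaces.linear_iff)

lemma bracket_zero_right [simp]: "bracket x 0 = 0"
  using bracket_scale_right[of x 0 0] by simp

lemma bracket_zero_left [simp]: "bracket 0 x = 0"
  using bracket_scale_left[of 0 0 x] by simp

lemma bracket_minus_right: "bracket x (- y) = - bracket x y"
  using bracket_scale_right[of x "-1" y] by simp

lemma bracket_minus_left: "bracket (- x) y = - bracket x y"
  using bracket_scale_left[of "-1" x y] by simp

lemma bracket_diff_right: "bracket x (y - z) = bracket x y - bracket x z"
  using bracket_add_right[of x y "-z"] by (simp add: bracket_minus_right)

lemma bracket_diff_left: "bracket (x - y) z = bracket x z - bracket y z"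
  using bracket_add_left[of x "-y" z] by (simp add: bracket_minus_left)

lemma bracket_self [simp]: "bracket x x = 0"
  by (rule alternating)

lemmas bracket_simps =
  bracket_add_right bracket_add_left bracket_scale_right bracket_scale_left
  bracket_minus_right bracket_minus_left bracket_diff_right bracket_diff_left

lemma bracket_swap: "bracket x y = - bracket y x"
  using alternating[of "x + y"] 
  by (simp add: bracket_simps alternating[of x] alternating[of y] eq_neg_iff_add_eq_0 add.commute
      del: bracket_self)

lemma bracket_derivation: "bracket x (bracket y z) = bracket (bracket x y) z + bracket y (bracket x z)"
proof -
  have "bracket x (bracket y z) = - bracket y (bracket z x) - bracket z (bracket x y)"
    using jacobi[of x y z] by (metis add.assoc add_diff_cancel_right' diff_0 minus_add_distrib diff_conv_add_uminus eq_neg_iff_add_eq_0)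
  also have "\<dots> = bracket y (bracket x z) + bracket (bracket x y) z"
    by (subst bracket_swap[of z x], subst bracket_swap[of z]) (simp add: bracket_minus_right)
  finally show ?thesis by (simp add: add.commute)
qed

lemma bracket_eq_0_swap: "bracket x y = 0 \<Longrightarrow> bracket y x = 0"
  by (subst bracket_swap) simp

lemma subspace_centralizer: "subspace {z. bracket z y = 0}"
  by (auto simp: subspace_def bracket_simps)

lemma ad_power_linear:
  "(bracket x ^^ n) (y + z) = (bracket x ^^ n) y + (bracket x ^^ n) z"
  "(bracket x ^^ n) (scale c y) = scale c ((bracket x ^^ n) y)"
  "(bracket x ^^ n) 0 = 0"
  by (induction n) (simp_all add: bracket_simps)

lemma coeff_ad_pencil_mem:
  assumes "subalgebra A" "x \<in> A" "y \<in> A"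
  shows "coeff ((ad_pencil x y ^^ n) [:x:]) i \<in> A"
proof -
  have sub: "subspace A" and br: "\<And>u v. u \<in> A \<Longrightarrow> v \<in> A \<Longrightarrow> bracket u v \<in> A"
    using assms(1) by (auto simp: subalgebra_def)
  show ?thesis
  proof (induction n arbitrary: i)
    case 0
    then show ?case using assms sub by (auto simp: coeff_pCons subspace_0 split: nat.splits)
  next
    case (Suc n)
    then show ?case using assms sub
      by (auto simp: ad_pencil_def coeff_pCons coeff_map_poly subspace_0 br subspace_add split: nat.splits)
  qed
qed

lemma jacobson_term_mem:
  assumes "subalgebra A" "x \<in> A" "y \<in> A"
  shows "jacobson_term p i x y \<in> A"
  using coeff_ad_pencil_mem[OF assms] assms(1)
  by (auto simp: jacobson_term_def subalgebra_def intro: subspace_scale)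

lemma ad_pencil_0 [simp]: "ad_pencil x y 0 = 0"
  by (simp add: ad_pencil_def)

lemma ad_pencil_power_0: "(ad_pencil x y ^^ n) 0 = 0"
  by (induction n) auto

lemma ad_pencil_const: "ad_pencil x y [:z:] = [:bracket y z, bracket x z:]"
  by (intro poly_eqI)
    (auto simp: ad_pencil_def coeff_pCons coeff_map_poly split: nat.splits)

lemma jacobson_term_eq_0:
  assumes "m \<le> p - 1" "(ad_pencil x y ^^ m) [:x:] = 0"
  shows "jacobson_term p i x y = 0"
proof -
  have "(ad_pencil x y ^^ (p - 1)) [:x:] = (ad_pencil x y ^^ (p - 1 - m)) ((ad_pencil x y ^^ m) [:x:])"
    using assms(1) by (metis funpow_add le_add_diff_inverse2 o_apply)
  then show ?thesis by (simp add: jacobson_term_def assms ad_pencil_power_0)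
qed

text \<open>Modulo \<open>W\<close> the vector \<open>v\<close> is an eigenvector of
  \<open>ad x\<close>, so \<open>(ad x)^n\<close> multiplies it by \<open>c^n\<close>; nilpotency
  leaves only \<open>c = 0\<close> or \<open>v\<close> in \<open>W\<close>.\<close>

lemma nilpotent_eigenvalue_mod:
  assumes W: "subspace W" "\<And>w. w \<in> W \<Longrightarrow> bracket x w \<in> W"
    and v: "bracket x v - scale c v \<in> W" "(bracket x ^^ n) v = 0"
  shows "scale c v \<in> W"
proof (cases "c = 0")
  case False
  have "(bracket x ^^ m) v - scale (c ^ m) v \<in> W" for m
  proof (induction m)
    case (Suc m)
    have "bracket x ((bracket x ^^ m) v - scale (c ^ m) v) + scale (c ^ m) (bracket x v - scale c v) \<in> W"
      using W v(1) Suc by (intro subspace_add subspace_scale) auto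
    then show ?case by (simp add: bracket_simps algebra_simps)
  qed (simp add: W subspace_0)
  then have "- scale (c ^ n) v \<in> W" using v(2) by (metis diff_0)
  then have "scale (- c / c ^ n) (- scale (c ^ n) v) \<in> W" using W by (intro subspace_scale)
  then show ?thesis using False by simp
qed (simp add: W subspace_0)

lemma brackets_eq_0:
  assumes "\<And>x y. x \<in> A \<Longrightarrow> y \<in> B \<Longrightarrow> bracket x y = 0"
  shows "brackets A B = {0}"
proof
  show "brackets A B \<subseteq> {0}"
    unfolding brackets_def by (rule span_minimal) (use assms in auto)
  show "{0} \<subseteq> brackets A B" by (simp add: brackets_def span_zero)
qed

lemma lower_central_2: "lower_central M 2 = brackets M M"
  by (simp add: lower_central_def)

lemma lower_central_3: "lower_central M 3 = brackets (brackets M M) M"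
  by (simp add: lower_central_def numeral_3_eq_3)

end

subsection \<open>Cyclic restricted subalgebras\<close>

context restricted_lie_algebra
begin

lemma prime_char: "prime CHAR('k)"
  using char_pos by (rule prime_CHAR_semidom)

lemma char_ge_2: "CHAR('k) \<ge> 2"
  using prime_char by (rule prime_ge_2_nat)

lemma pmap_0 [simp]: "pmap 0 = 0"
  using pmap_scale[of 0 0] char_pos by (simp add: power_0_left)

section \<open>Special cases of Jacobson's formula\<close>

lemma pmap_add_commuting:
  assumes "bracket x y = 0"
  shows "pmap (x + y) = pmap x + pmap y"
proof -
  have "jacobson_term CHAR('k) i x y = 0" for i
    using char_ge_2 bracket_eq_0_swap[OF assms]
    by (intro jacobson_term_eq_0[of 1]) (auto simp: ad_pencil_const)
  then show ?thesis by (simp add: pmap_add)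
qed

text \<open>Two applications of the pencil already produce only double brackets, and
  \<open>p - 1 \<ge> 2\<close> because \<open>p\<close> is an odd prime.\<close>

lemma pmap_add_class_2:
  assumes "\<And>x y z. bracket x (bracket y z) = 0" "CHAR('k) \<noteq> 2"
  shows "pmap (x + y) = pmap x + pmap y"
proof -
  have "jacobson_term CHAR('k) i x y = 0" for i
    using char_ge_2 assms(2)
    by (intro jacobson_term_eq_0[of 2])
      (auto simp: numeral_2_eq_2 ad_pencil_const assms(1))
  then show ?thesis by (simp add: pmap_add)
qed

text \<open>The pencil fixes the constant polynomial \<open>a\<close>, since
  \<open>[a, a] = 0\<close> and \<open>[t, a] = a\<close>. Hence the only nonzero Jacobson term is
  the one with \<open>i = 1\<close>, and it equals \<open>a\<close>.\<close>

lemma pmap_add_eigenvector: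
  assumes "bracket t a = a"
  shows "pmap (a + t) = pmap a + pmap t + a"
proof -
  have "(ad_pencil a t ^^ n) [:a:] = [:a:]" for n
    by (induction n) (auto simp: ad_pencil_const assms)
  then have "jacobson_term CHAR('k) i a t = (if i = 1 then a else 0)" if "i \<ge> 1" for i
    using that by (auto simp: jacobson_term_def coeff_pCons split: nat.splits)
  then have "(\<Sum>i = 1..CHAR('k) - 1. jacobson_term CHAR('k) i a t)
      = (\<Sum>i = 1..CHAR('k) - 1. if i = 1 then a else 0)"
    by (intro sum.cong) auto
  also have "\<dots> = a"
    using char_ge_2 by (auto simp: sum.delta)
  finally show ?thesis by (simp add: pmap_add)
qed

lemma bracket_pmap_eq_0:
  assumes "(bracket x ^^ n) y = 0" "n \<le> CHAR('k)"
  shows "bracket (pmap x) y = 0"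
proof -
  have "(bracket x ^^ CHAR('k)) y = (bracket x ^^ (CHAR('k) - n)) ((bracket x ^^ n) y)"
    using assms(2) by (metis funpow_add le_add_diff_inverse2 o_apply)
  then show ?thesis by (simp add: bracket_pmap assms ad_power_linear)
qed

lemma bracket_pmap_power:
  "bracket ((pmap ^^ n) x) y = (bracket x ^^ (CHAR('k) ^ n)) y"
proof (induction n arbitrary: y)
  case (Suc n)
  then have "bracket ((pmap ^^ n) x) = (bracket x ^^ (CHAR('k) ^ n))" by auto
  then show ?case by (simp add: bracket_pmap funpow_mult mult.commute)
qed simp

lemma bracket_pmap_power_commuting:
  assumes "bracket x y = 0"
  shows "bracket ((pmap ^^ n) x) y = 0"
  by (induction n) (use assms char_pos in \<open>auto intro: bracket_pmap_eq_0[where n = 1]\<close>)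

lemma pmap_power_scale:
  "(pmap ^^ n) (scale c x) = scale (c ^ (CHAR('k) ^ n)) ((pmap ^^ n) x)"
  by (induction n) (simp_all add: pmap_scale power_mult[symmetric] mult.commute)

lemma pmap_power_0 [simp]: "(pmap ^^ n) 0 = 0"
  by (induction n) auto

text \<open>Only additivity is demanded, because \<open>pmap_scale\<close> gives the behaviour on
  scalar multiples everywhere.\<close>

definition semilinear_on :: "'a set \<Rightarrow> bool" where
  "semilinear_on A \<longleftrightarrow> subspace A \<and> (\<forall>x\<in>A. pmap x \<in> A) \<and>
    (\<forall>x\<in>A. \<forall>y\<in>A. pmap (x + y) = pmap x + pmap y)"

lemma pmap_power_mem: "semilinear_on A \<Longrightarrow> x \<in> A \<Longrightarrow> (pmap ^^ n) x \<in> A"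
  by (induction n) (auto simp: semilinear_on_def)

lemma pmap_power_add:
  assumes "semilinear_on A" "x \<in> A" "y \<in> A"
  shows "(pmap ^^ n) (x + y) = (pmap ^^ n) x + (pmap ^^ n) y"
  by (induction n) (use assms pmap_power_mem[OF assms(1)] in \<open>auto simp: semilinear_on_def\<close>)

lemma pmap_power_diff:
  assumes "semilinear_on A" "x \<in> A" "y \<in> A"
  shows "(pmap ^^ n) (x - y) = (pmap ^^ n) x - (pmap ^^ n) y"
proof -
  have "x - y \<in> A" using assms by (auto simp: semilinear_on_def subspace_diff)
  then have "(pmap ^^ n) (x - y + y) = (pmap ^^ n) (x - y) + (pmap ^^ n) y"
    using assms pmap_power_add by blast
  then show ?thesis by simp
qed

lemma pmap_sum:
  fixes n :: nat
  assumes "semilinear_on A" "\<And>i. v i \<in> A"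
  shows "pmap (\<Sum>i\<le>n. scale (c i) (v i)) = (\<Sum>i\<le>n. scale (c i ^ CHAR('k)) (pmap (v i)))"
proof -
  have sub: "subspace A" using assms by (simp add: semilinear_on_def)
  have "(\<Sum>i\<le>n. scale (c i) (v i)) \<in> A \<and>
     pmap (\<Sum>i\<le>n. scale (c i) (v i)) = (\<Sum>i\<le>n. scale (c i ^ CHAR('k)) (pmap (v i)))"
  proof (induction n)
    case 0
    then show ?case using assms sub by (simp add: pmap_scale subspace_scale)
  next
    case (Suc n)
    have "scale (c (Suc n)) (v (Suc n)) \<in> A" using assms sub by (simp add: subspace_scale)
    with Suc assms sub show ?case
      by (simp add: pmap_scale subspace_add semilinear_on_def)
  qed
  then show ?thesis by blast
qed

definition cyclic :: "'a \<Rightarrow> 'a set" where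
  "cyclic x = span (range (\<lambda>i. (pmap ^^ i) x))"

lemma subspace_cyclic [simp]: "subspace (cyclic x)"
  by (simp add: cyclic_def)

lemma pmap_power_in_cyclic: "(pmap ^^ i) x \<in> cyclic x"
  by (auto simp: cyclic_def intro: span_base)

lemma self_in_cyclic [simp]: "x \<in> cyclic x"
  using pmap_power_in_cyclic[of 0] by simp

lemma cyclic_subset:
  assumes "subspace A" "\<And>i. (pmap ^^ i) x \<in> A"
  shows "cyclic x \<subseteq> A"
  unfolding cyclic_def by (rule span_minimal) (use assms in auto)

lemma bracket_cyclic:
  assumes "bracket x y = 0" "u \<in> cyclic x"
  shows "bracket u y = 0"
  using cyclic_subset[OF subspace_centralizer[of y], of x] assms bracket_pmap_power_commuting
  by blast

lemma cyclic_abelian: "u \<in> cyclic x \<Longrightarrow> v \<in> cyclic x \<Longrightarrow> bracket u v = 0"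
  by (meson alternating bracket_cyclic bracket_eq_0_swap)

text \<open>Elements of \<open>cyclic x\<close> commute, so \<open>pmap\<close> is additive there;
  the elements with image in \<open>cyclic x\<close> thus form a subspace containing all iterates of
  \<open>x\<close>.\<close>

lemma pmap_in_cyclic:
  assumes "u \<in> cyclic x"
  shows "pmap u \<in> cyclic x"
proof -
  have "cyclic x \<subseteq> {u \<in> cyclic x. pmap u \<in> cyclic x}"
  proof (rule cyclic_subset)
    show "subspace {u \<in> cyclic x. pmap u \<in> cyclic x}"
      unfolding subspace_def
      by (auto simp: subspace_0 subspace_add subspace_scale pmap_scale pmap_add_commuting cyclic_abelian)
    show "(pmap ^^ i) x \<in> {u \<in> cyclic x. pmap u \<in> cyclic x}" for i
      using pmap_power_in_cyclic[of i x] pmap_power_in_cyclic[of "Suc i" x] by simp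
  qed
  with assms show ?thesis by blast
qed

lemma semilinear_on_cyclic: "semilinear_on (cyclic x)"
  by (auto simp: semilinear_on_def pmap_in_cyclic pmap_add_commuting cyclic_abelian)

lemma restricted_subalgebra_cyclic: "restricted_subalgebra (cyclic x)"
  by (auto simp: restricted_subalgebra_def subalgebra_def pmap_in_cyclic cyclic_abelian subspace_0)

lemma cyclic_minimal:
  assumes "restricted_subalgebra A" "x \<in> A"
  shows "cyclic x \<subseteq> A"
proof (rule cyclic_subset)
  show "(pmap ^^ i) x \<in> A" for i
    by (induction i) (use assms in \<open>auto simp: restricted_subalgebra_def\<close>)
qed (use assms in \<open>auto simp: restricted_subalgebra_def subalgebra_def\<close>)

lemma cyclic_mono: "y \<in> cyclic x \<Longrightarrow> cyclic y \<subseteq> cyclic x"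
  by (intro cyclic_minimal restricted_subalgebra_cyclic)

lemma generated_singleton: "generated {x} = cyclic x"
  unfolding generated_def
  by (rule hull_unique) (auto simp: restricted_subalgebra_cyclic dest: cyclic_minimal)

lemma cyclic_pmap_subset: "cyclic (pmap x) \<subseteq> cyclic x"
  by (simp add: cyclic_mono pmap_in_cyclic)

text \<open>Isolates the coefficient of \<open>x\<close>. In the ad-nilpotent case this turns a
  quasi-ideal relation into an eigenvector relation modulo a subspace.\<close>

lemma cyclicE:
  assumes "u \<in> cyclic x"
  obtains c v where "v \<in> cyclic (pmap x)" "u = scale c x + v"
proof -
  have "(\<lambda>i. (pmap ^^ i) x) i \<in> insert x (range (\<lambda>i. (pmap ^^ i) (pmap x)))" for i
    by (cases i) (auto simp: funpow_swap1)
  then have "cyclic x \<subseteq> span (insert x (range (\<lambda>i. (pmap ^^ i) (pmap x))))"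
    by (intro cyclic_subset subspace_span span_base)
  then obtain c where "u - scale c x \<in> cyclic (pmap x)"
    using assms span_breakdown_eq unfolding cyclic_def by blast
  then show ?thesis using that[of "u - scale c x" c] by simp
qed

lemma cyclic_eq_line:
  assumes "pmap x = scale c x" "u \<in> cyclic x"
  obtains b where "u = scale b x"
proof -
  have "(pmap ^^ i) x \<in> span {x}" for i
  proof (induction i)
    case (Suc i)
    then show ?case by (auto simp: span_singleton pmap_scale assms(1))
  qed (simp add: span_base)
  then have "cyclic x \<subseteq> span {x}" by (intro cyclic_subset) auto
  then show ?thesis using assms(2) that by (auto simp: span_singleton)
qed

text \<open>The quasi-ideal property closes the sum under mixed brackets; it is then a subalgebra,
  so it contains the Jacobson terms of its elements and is closed under \<open>pmap\<close>.\<close>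

lemma restricted_subalgebra_plus:
  assumes "restricted_quasi_ideal A" "restricted_subalgebra B"
  shows "restricted_subalgebra (A + B)"
proof -
  have A: "restricted_subalgebra A" and sub: "subspace A" "subspace B"
    using assms by (auto simp: restricted_quasi_ideal_def restricted_subalgebra_def subalgebra_def)
  have AB: "bracket a b \<in> A + B" if "a \<in> A" "b \<in> B" for a b
  proof -
    have "bracket a b \<in> brackets A B"
      using that by (auto simp: brackets_def intro!: span_base)
    then show ?thesis using assms by (auto simp: restricted_quasi_ideal_def)
  qed
  have sum: "subspace (A + B)"
  proof -
    have "A + B = {x + y |x y. x \<in> A \<and> y \<in> B}" by (auto simp: set_plus_def)
    then show ?thesis using subspace_sums[OF sub] by simp
  qed
  have in_sum: "a \<in> A + B" "b \<in> A + B" if "a \<in> A" "b \<in> B" for a b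
    using that sub by (metis add.right_neutral add_0 set_plus_intro subspace_0)+
  have alg: "subalgebra (A + B)"
    unfolding subalgebra_def
  proof (intro conjI ballI sum)
    fix x y assume "x \<in> A + B" "y \<in> A + B"
    then obtain a b a' b' where x: "x = a + b" "y = a' + b'" and *: "a \<in> A" "b \<in> B" "a' \<in> A" "b' \<in> B"
      by (auto elim!: set_plus_elim)
    have "bracket x y = bracket a a' + bracket a b' + (- bracket a' b + bracket b b')"
      by (simp add: x bracket_simps bracket_swap[of b a'] add_ac)
    moreover have "bracket a a' \<in> A + B" "bracket b b' \<in> A + B"
      using * A assms(2) in_sum sub by (auto simp: restricted_subalgebra_def subalgebra_def subspace_0)
    ultimately show "bracket x y \<in> A + B"
      using AB * sum by (simp add: subspace_add subspace_diff)
  qed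
  have "pmap x \<in> A + B" if "x \<in> A + B" for x
  proof -
    from that obtain a b where x: "x = a + b" and *: "a \<in> A" "b \<in> B"
      by (auto elim!: set_plus_elim)
    have "pmap a \<in> A + B" "pmap b \<in> A + B"
      using * A assms(2) in_sum by (auto simp: restricted_subalgebra_def)
    then show ?thesis
      using * in_sum alg sum unfolding x pmap_add
      by (intro subspace_add subspace_sum jacobson_term_mem) auto
  qed
  with alg show ?thesis by (simp add: restricted_subalgebra_def)
qed

end

section \<open>Finite dimension over an algebraically closed field\<close>

locale fin_restricted_lie_algebra =
  restricted_lie_algebra scale bracket pmap + finite_dimensional_vector_space scale Basis
  for scale :: "'k::alg_closed_field \<Rightarrow> 'a::ab_group_add \<Rightarrow> 'a"
    and bracket :: "'a \<Rightarrow> 'a \<Rightarrow> 'a" and pmap :: "'a \<Rightarrow> 'a" and Basis :: "'a set"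
begin

lemma subspace_pmap_power_image:
  assumes "semilinear_on A"
  shows "subspace ((pmap ^^ n) ` A)"
  unfolding subspace_def
proof (intro conjI ballI allI)
  have sub: "subspace A" using assms by (simp add: semilinear_on_def)
  show "0 \<in> (pmap ^^ n) ` A" using sub by (metis image_eqI pmap_power_0 subspace_0)
  show "x + y \<in> (pmap ^^ n) ` A" if xy: "x \<in> (pmap ^^ n) ` A" "y \<in> (pmap ^^ n) ` A" for x y
  proof -
    obtain u v where "x = (pmap ^^ n) u" "y = (pmap ^^ n) v" "u \<in> A" "v \<in> A"
      using xy by blast
    then show ?thesis using sub pmap_power_add[OF assms, of u v n] by (metis image_eqI subspace_add)
  qed
  show "scale c x \<in> (pmap ^^ n) ` A" if x: "x \<in> (pmap ^^ n) ` A" for c x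
  proof -
    obtain u where "x = (pmap ^^ n) u" "u \<in> A" using x by blast
    \<comment> \<open>The image absorbs the scalar \<open>c\<close> because \<open>c\<close> has a
      \<open>p^n\<close>-th root.\<close>
    moreover obtain b where "b ^ (CHAR('k) ^ n) = c"
      using nth_root_exists[of "CHAR('k) ^ n" c] char_pos by auto
    ultimately show ?thesis using sub by (metis image_eqI pmap_power_scale subspace_scale)
  qed
qed

text \<open>Some iterate \<open>pmap^m x\<close> is a combination of later ones, hence equals
  \<open>pmap^m u\<close> with \<open>u\<close> in \<open>cyclic (pmap x)\<close>; injectivity
  cancels \<open>pmap^m\<close>.\<close>

lemma semisimple_if_pmap_injective:
  assumes "\<And>z. z \<in> cyclic x \<Longrightarrow> pmap z = 0 \<Longrightarrow> z = 0"
  shows "x \<in> cyclic (pmap x)"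
proof -
  obtain m where m: "(pmap ^^ m) x \<in> span ((\<lambda>i. (pmap ^^ i) x) ` {m<..})"
    using in_span_of_later[of "\<lambda>i. (pmap ^^ i) x"] by blast
  have "(pmap ^^ i) x \<in> (pmap ^^ m) ` cyclic (pmap x)" if "m < i" for i
  proof -
    have "(pmap ^^ i) x = (pmap ^^ m) ((pmap ^^ (i - Suc m)) (pmap x))"
    proof -
      have "(pmap ^^ (m + (i - Suc m) + 1)) x = (pmap ^^ m) ((pmap ^^ (i - Suc m)) (pmap x))"
        by (simp only: funpow_add o_apply) simp
      then show ?thesis using that by simp
    qed
    then show ?thesis using pmap_power_in_cyclic by blast
  qed
  then have "span ((\<lambda>i. (pmap ^^ i) x) ` {m<..}) \<subseteq> (pmap ^^ m) ` cyclic (pmap x)"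
    by (intro span_minimal subspace_pmap_power_image semilinear_on_cyclic) auto
  then obtain u where u: "u \<in> cyclic (pmap x)" "(pmap ^^ m) x = (pmap ^^ m) u"
    using m by blast
  then have ux: "x - u \<in> cyclic x" and "u \<in> cyclic x"
    using cyclic_pmap_subset by (auto intro!: subspace_diff)
  then have "(pmap ^^ m) (x - u) = 0"
    using u by (simp add: pmap_power_diff[OF semilinear_on_cyclic self_in_cyclic])
  moreover have "z = 0" if "(pmap ^^ m) z = 0" "z \<in> cyclic x" for z
    using that
  proof (induction m)
    case (Suc m)
    then show ?case using assms pmap_power_mem[OF semilinear_on_cyclic] by simp
  qed simp
  ultimately have "x - u = 0" using ux by blast
  then show ?thesis using u by simp
qed

text \<open>With the ansatz that \<open>w\<close> is the sum of \<open>c i\<close> times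
  \<open>pmap^i g\<close> for \<open>i \<le> n\<close>, comparing coefficients gives
  \<open>c 0 = a 0 * x^p - 1\<close> and \<open>c (i + 1) = (c i)^p + a (i + 1) * x^p\<close>, where
  \<open>x = c n\<close>. What remains is one polynomial equation for \<open>x\<close>.\<close>

lemma artin_schreier_solution:
  obtains w where "w \<in> cyclic g" "pmap w = w + g"
proof -
  obtain m where m: "(pmap ^^ m) g \<in> span ((\<lambda>i. (pmap ^^ i) g) ` {..<m})"
    using in_span_of_earlier[of "\<lambda>i. (pmap ^^ i) g"] by blast
  show ?thesis
  proof (cases m)
    case 0
    then show ?thesis using m that[of 0] by (simp add: subspace_0)
  next
    case (Suc n)
    then obtain a where a: "(pmap ^^ Suc n) g = (\<Sum>i<Suc n. scale (a i) ((pmap ^^ i) g))"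
      using in_span_lessThanE[of "(pmap ^^ m) g" "\<lambda>i. (pmap ^^ i) g" m] m by auto
    define p where "p = CHAR('k)"
    \<comment> \<open>\<open>C i\<close> is the coefficient \<open>c i\<close> as a polynomial in
      the unknown \<open>x = c n\<close>; consistency requires \<open>C n\<close> to take the value
      \<open>x\<close> at \<open>x\<close>.\<close>
    define C where "C = rec_nat (monom (a 0) p - 1) (\<lambda>i q. q ^ p + monom (a (Suc i)) p)"
    have C_simps: "C 0 = monom (a 0) p - 1" "C (Suc i) = C i ^ p + monom (a (Suc i)) p" for i
      by (simp_all add: C_def)
    \<comment> \<open>Every exponent is a multiple of \<open>p\<close>. So \<open>C n - X\<close>
      has derivative -1, is not constant, and has a root.\<close>
    have "pderiv (C i) = 0" for i
      by (cases i) (simp_all add: C_simps pderiv_diff pderiv_add pderiv_monom pderiv_power p_def)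
    then have "pderiv (C n - [:0, 1:]) = -1"
      by (simp add: pderiv_diff pderiv_pCons one_pCons)
    then have "degree (C n - [:0, 1:]) > 0"
      by (metis degree_eq_zeroE gr0I neg_equal_0_iff_equal one_neq_zero pderiv_singleton)
    then obtain x where "poly (C n - [:0, 1:]) x = 0"
      using alg_closed_imp_poly_has_root by blast
    then have x: "poly (C n) x = x" by simp
    define c where "c i = poly (C i) x" for i
    define w where "w = (\<Sum>i\<le>n. scale (c i) ((pmap ^^ i) g))"
    have "w \<in> cyclic g"
      unfolding w_def by (intro subspace_sum subspace_scale) (auto simp: pmap_power_in_cyclic)
    moreover have "pmap w = w + g"
    proof -
      have "pmap w = (\<Sum>i<Suc n. scale (c i ^ p) ((pmap ^^ Suc i) g))"
        unfolding w_def p_def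
        by (subst pmap_sum[OF semilinear_on_cyclic[of g]])
          (auto simp: pmap_power_in_cyclic lessThan_Suc_atMost)
      also have "\<dots> = (\<Sum>i<n. scale (c i ^ p) ((pmap ^^ Suc i) g)) + scale (x ^ p) ((pmap ^^ Suc n) g)"
        by (simp add: c_def x)
      also have "scale (x ^ p) ((pmap ^^ Suc n) g)
          = scale (x ^ p * a 0) g + (\<Sum>i<n. scale (x ^ p * a (Suc i)) ((pmap ^^ Suc i) g))"
        unfolding a by (subst sum.lessThan_Suc_shift) (simp add: scale_right_distrib scale_sum_right)
      finally have "pmap w = scale (x ^ p * a 0) g + (\<Sum>i<n. scale (c (Suc i)) ((pmap ^^ Suc i) g))"
        by (simp add: c_def C_simps poly_monom scale_left_distrib sum.distrib mult.commute add_ac)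
      moreover have "w = scale (c 0) g + (\<Sum>i<n. scale (c (Suc i)) ((pmap ^^ Suc i) g))"
        unfolding w_def by (simp add: sum.lessThan_Suc_shift flip: lessThan_Suc_atMost del: sum.lessThan_Suc)
      ultimately show ?thesis
        by (simp add: c_def C_simps poly_monom scale_left_diff_distrib mult.commute)
    qed
    ultimately show ?thesis using that by blast
  qed
qed

text \<open>As \<open>pmap x - x\<close> commutes with \<open>y\<close>, subtracting an Artin-Schreier root of it from \<open>x\<close> does not
  change the action on \<open>y\<close>.\<close>
lemma toral_element:
  assumes "bracket x y = y"
  obtains t where "t \<in> cyclic x" "pmap t = t" "bracket t y = y"
proof -
  define g where "g = pmap x - x"
  have "(bracket x ^^ n) y = y" for n by (induction n) (auto simp: assms)
  then have gy: "bracket g y = 0" by (simp add: g_def bracket_simps bracket_pmap assms)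
  have g: "g \<in> cyclic x" by (auto simp: g_def pmap_in_cyclic intro!: subspace_diff)
  obtain w where w: "w \<in> cyclic g" "pmap w = w + g" using artin_schreier_solution .
  have wx: "w \<in> cyclic x" using w g cyclic_mono by blast
  show ?thesis
  proof (rule that[of "x - w"])
    show "x - w \<in> cyclic x" using wx by (auto intro!: subspace_diff)
    show "pmap (x - w) = x - w"
      using pmap_power_diff[OF semilinear_on_cyclic self_in_cyclic wx, of 1] w by (simp add: g_def)
    show "bracket (x - w) y = y"
      using bracket_cyclic[OF gy w(1)] by (simp add: bracket_simps assms)
  qed
qed

text \<open>With \<open>D = ad x\<close>, a vector \<open>v = D^m y\<close> in the span of later
  iterates satisfies \<open>v = D q(D) v\<close>, so \<open>1 - X q\<close> kills it. The constant
  term 1 rules out the eigenvalue 0.\<close>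

lemma nonzero_eigenvector:
  assumes "\<And>n. (bracket x ^^ n) y \<noteq> 0" "y \<in> U" "subspace U" "\<And>u. u \<in> U \<Longrightarrow> bracket x u \<in> U"
  obtains w c where "w \<in> U" "w \<noteq> 0" "c \<noteq> 0" "bracket x w = scale c w"
proof -
  obtain m where m: "(bracket x ^^ m) y \<in> span ((\<lambda>i. (bracket x ^^ i) y) ` {m<..})"
    using in_span_of_later[of "\<lambda>i. (bracket x ^^ i) y"] by blast
  define v where "v = (bracket x ^^ m) y"
  have v: "v \<noteq> 0" using assms(1) by (simp add: v_def)
  have U: "(bracket x ^^ n) y \<in> U" for n by (induction n) (auto simp: assms)
  have hom: "module_hom scale scale (bracket x)"
    using linear_right[of x] by (simp add: module_hom_iff_linear)
  let ?A = "{poly_act scale (bracket x) (pCons 0 q) v | q. True}"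
  have "span ((\<lambda>i. (bracket x ^^ i) y) ` {m<..}) \<subseteq> ?A"
  proof (rule span_minimal)
    show "subspace ?A"
      unfolding subspace_def
    proof (intro conjI ballI allI)
      show "0 \<in> ?A" by (auto intro!: exI[of _ 0])
      show "a + b \<in> ?A" if ab: "a \<in> ?A" "b \<in> ?A" for a b
      proof -
        from ab obtain q r where "a = poly_act scale (bracket x) (pCons 0 q) v" "b = poly_act scale (bracket x) (pCons 0 r) v"
          by auto
        then show ?thesis by (auto intro!: exI[of _ "q + r"] simp: poly_act_add)
      qed
      show "scale c a \<in> ?A" if a: "a \<in> ?A" for c a
      proof -
        from a obtain q where "a = poly_act scale (bracket x) (pCons 0 q) v" by auto
        then show ?thesis by (auto intro!: exI[of _ "smult c q"] simp: poly_act_smult)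
      qed
    qed
    have pow: "poly_act scale (bracket x) (monom 1 n) u = (bracket x ^^ n) u" for n u
      by (induction n arbitrary: u) (simp_all add: monom_0 monom_Suc funpow_swap1)
    show "(\<lambda>i. (bracket x ^^ i) y) ` {m<..} \<subseteq> ?A"
    proof clarify
      fix i assume "m < i"
      have "(bracket x ^^ i) y = (bracket x ^^ Suc (i - Suc m)) v"
        using \<open>m < i\<close> by (simp add: v_def del: funpow.simps flip: funpow_add[THEN fun_cong, unfolded o_apply])
      also have "\<dots> = poly_act scale (bracket x) (pCons 0 (monom 1 (i - Suc m))) v"
        by (simp add: pow funpow_swap1)
      finally show "\<exists>q. (bracket x ^^ i) y = poly_act scale (bracket x) (pCons 0 q) v \<and> True" by blast
    qed
  qed
  then obtain q where q: "v = poly_act scale (bracket x) (pCons 0 q) v"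
    using m by (auto simp: v_def)
  have "poly_act scale (bracket x) (pCons 1 (- q)) v = 0"
    using q poly_act_smult[of "bracket x" "-1" q "bracket x v"] by simp
  then have "\<exists>c w. poly (pCons 1 (- q)) c = 0 \<and> w \<in> U \<and> w \<noteq> 0 \<and> bracket x w = scale c w"
    using v U assms(3,4) alg_closed_imp_poly_has_root
    by (intro eigenvector_of_annihilator[OF hom]) (auto simp: v_def)
  then obtain c w where cw: "poly (pCons 1 (- q)) c = 0" "w \<in> U" "w \<noteq> 0" "bracket x w = scale c w"
    by blast
  then have "c \<noteq> 0" by auto
  with cw that show ?thesis by blast
qed

end

subsection \<open>Toral elements with a nonzero weight\<close>

locale all_quasi_ideals = fin_restricted_lie_algebra scale bracket pmap Basis
  for scale :: "'k::alg_closed_field \<Rightarrow> 'a::ab_group_add \<Rightarrow> 'a"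
    and bracket :: "'a \<Rightarrow> 'a \<Rightarrow> 'a" and pmap :: "'a \<Rightarrow> 'a" and Basis :: "'a set" +
  assumes char_neq_2: "CHAR('k) \<noteq> 2"
    and quasi_ideal: "restricted_subalgebra A \<Longrightarrow> restricted_quasi_ideal A"
begin

lemma char_ge_3: "CHAR('k) \<ge> 3"
  using char_ge_2 char_neq_2 by linarith

lemma two_neq_0: "(2::'k) \<noteq> 0"
proof
  assume "(2::'k) = 0"
  then have "of_nat 2 = (0::'k)" by simp
  then have "CHAR('k) dvd 2" by (simp only: of_nat_eq_0_iff_char_dvd)
  then show False using char_ge_3 by (auto dest: dvd_imp_le)
qed

lemma bracket_in_plus:
  assumes "restricted_subalgebra A" "restricted_subalgebra B" "a \<in> A" "b \<in> B"
  obtains a' b' where "bracket a b = a' + b'" "a' \<in> A" "b' \<in> B"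
proof -
  have "bracket a b \<in> brackets A B"
    using assms by (auto simp: brackets_def intro!: span_base)
  then have "bracket a b \<in> A + B"
    using quasi_ideal assms by (auto simp: restricted_quasi_ideal_def)
  then show ?thesis using that by (auto elim!: set_plus_elim)
qed

lemma bracket_cyclicE:
  obtains u v where "bracket x y = u + v" "u \<in> cyclic x" "v \<in> cyclic y"
  using bracket_in_plus[OF restricted_subalgebra_cyclic restricted_subalgebra_cyclic]
    self_in_cyclic by metis

lemma restricted_subalgebra_sum:
  "restricted_subalgebra A \<Longrightarrow> restricted_subalgebra B \<Longrightarrow> restricted_subalgebra (A + B)"
  using restricted_subalgebra_plus quasi_ideal by blast

text \<open>Here \<open>z = pmap y\<close> commutes with \<open>y\<close> and \<open>t\<close>, and
  \<open>pmap (y + t) = z + t + y\<close>. A correction \<open>d\<close> with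
  \<open>pmap d = d - z\<close> makes \<open>s = y + t + d\<close> toral, so
  \<open>y = [t, s]\<close> lies in the span of \<open>t\<close> and \<open>s\<close>. Applying
  \<open>ad t\<close>, then bracketing with \<open>y\<close>, forces \<open>d = 0\<close>.\<close>

lemma pmap_weight_vector:
  assumes t: "pmap t = t" and y: "bracket t y = y"
  shows "pmap y = 0"
proof (cases "y = 0")
  case False
  define z where "z = pmap y"
  have zy: "bracket z y = 0"
    using char_ge_2 by (auto simp: z_def intro!: bracket_pmap_eq_0[where n = 1])
  have zt: "bracket z t = 0"
    using char_ge_2 y bracket_swap[of y t]
    by (auto simp: z_def numeral_2_eq_2 bracket_simps intro!: bracket_pmap_eq_0[where n = 2])
  obtain d where d: "d \<in> cyclic (- z)" "pmap d = d + (- z)"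
    using artin_schreier_solution .
  have dy: "bracket d y = 0" and dt: "bracket d t = 0"
    using bracket_cyclic[OF _ d(1)] zy zt by (simp_all add: bracket_minus_left)
  define s where "s = y + t + d"
  have "bracket (y + t) d = 0"
    using dy dt by (subst bracket_swap) (simp add: bracket_simps)
  then have s: "pmap s = s"
    using d(2) by (simp add: s_def pmap_add_commuting pmap_add_eigenvector[OF y] t z_def)
  obtain u v where uv: "bracket t s = u + v" "u \<in> cyclic t" "v \<in> cyclic s"
    using bracket_cyclicE .
  obtain a where a: "u = scale a t" using cyclic_eq_line[of t 1 u] uv t by auto
  obtain b where b: "v = scale b s" using cyclic_eq_line[of s 1 v] uv s by auto
  have td: "bracket t d = 0" using dt by (rule bracket_eq_0_swap)
  have eq: "y = scale a t + scale b (y + t + d)"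
    using uv a b y td by (simp add: s_def bracket_simps)
  then have "bracket t y = bracket t (scale a t + scale b (y + t + d))" by simp
  then have "y = scale b y" using y td by (simp add: bracket_simps)
  then have "b = 1" using False by (metis scale_one scale_right_imp_eq)
  then have *: "scale (a + 1) t + d = 0"
    using eq by (simp add: scale_left_distrib algebra_simps)
  then have "bracket (scale (a + 1) t + d) y = 0" by simp
  then have "scale (a + 1) y = 0" using y dy by (simp add: bracket_simps)
  then have "d = 0" using * False by simp
  then show ?thesis using d(2) by (simp add: z_def)
qed simp

text \<open>As \<open>r^p = r\<close>, the multiple \<open>t / r\<close> is again toral, and
  \<open>y\<close> has weight 1 for it.\<close>

lemma pmap_scaled_weight_vector:
  assumes "pmap t = t" "bracket t y = scale r y" "r \<noteq> 0" "r ^ CHAR('k) = r"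
  shows "pmap y = 0"
proof (rule pmap_weight_vector[where t = "scale (1 / r) t"])
  show "pmap (scale (1 / r) t) = scale (1 / r) t"
    using assms by (simp add: pmap_scale power_divide)
  show "bracket (scale (1 / r) t) y = y"
    using assms by (simp add: bracket_simps)
qed

lemma bracket_square_zero:
  assumes "pmap y = 0" "pmap z = 0"
  obtains a b where "bracket y z = scale a y + scale b z"
proof -
  obtain u v where uv: "bracket y z = u + v" "u \<in> cyclic y" "v \<in> cyclic z"
    using bracket_cyclicE .
  obtain a where "u = scale a y" using cyclic_eq_line[of y 0 u] uv assms by auto
  moreover obtain b where "v = scale b z" using cyclic_eq_line[of z 0 v] uv assms by auto
  ultimately show ?thesis using that uv by blast
qed

text \<open>Since \<open>pmap (h + y) = 0\<close>, the quasi-ideal property gives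
  \<open>r h + y = a t + b (h + y)\<close>. Bracketing with \<open>y\<close> yields
  \<open>a = 0\<close>; independence of the weights \<open>r\<close> and 1 does the rest.\<close>

lemma commuting_with_weight_vector:
  assumes t: "pmap t = t" and y: "bracket t y = y" "y \<noteq> 0"
    and h: "bracket t h = scale r h" "pmap h = 0" "bracket h y = 0" "r \<noteq> 1"
  shows "h = 0"
proof -
  have "pmap (h + y) = 0"
    using h pmap_weight_vector[OF t y(1)] by (simp add: pmap_add_commuting)
  obtain u v where uv: "bracket t (h + y) = u + v" "u \<in> cyclic t" "v \<in> cyclic (h + y)"
    using bracket_cyclicE .
  obtain a where a: "u = scale a t" using cyclic_eq_line[of t 1 u] uv t by auto
  obtain b where b: "v = scale b (h + y)"
    using cyclic_eq_line[of "h + y" 0 v] uv \<open>pmap (h + y) = 0\<close> by auto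
  have eq: "scale a t = scale (r - b) h + scale (1 - b) y"
    using uv(1) h(1) y(1) by (simp add: a b bracket_simps algebra_simps)
  have "bracket (scale a t) y = bracket (scale (r - b) h + scale (1 - b) y) y"
    using eq by simp
  then have "scale a y = 0" using y h by (simp add: bracket_simps)
  then have "a = 0" using y by simp
  then have sum0: "scale (r - b) h + scale (1 - b) y = 0" using eq by simp
  then have "bracket t (scale (r - b) h + scale (1 - b) y) = 0" by simp
  then have "scale r (scale (r - b) h) + scale (1 - b) y = 0"
    using h y by (simp add: bracket_simps mult.commute)
  moreover have "scale r (scale (r - b) h) + scale (1 - b) y - (scale (r - b) h + scale (1 - b) y)
      = scale ((r - 1) * (r - b)) h"
    by (simp add: algebra_simps)
  ultimately have "scale ((r - 1) * (r - b)) h = 0" using sum0 by simp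
  then show ?thesis using h(4) sum0 y(2) by auto
qed

text \<open>If \<open>r\<close> differs from 1, then \<open>[z, y]\<close> has weight
  \<open>r + 1\<close> but lies in the span of \<open>z\<close> and \<open>y\<close>, of weights
  \<open>r\<close> and 1, so it vanishes. The preceding lemma then gives
  \<open>z = 0\<close>.\<close>

lemma toral_weight_unique:
  assumes t: "pmap t = t" and y: "bracket t y = y" "y \<noteq> 0"
    and z: "bracket t z = scale r z" "z \<noteq> 0" "r \<noteq> 0" "r ^ CHAR('k) = r"
  shows "r = 1"
proof (rule ccontr)
  assume "r \<noteq> 1"
  have py: "pmap y = 0" and pz: "pmap z = 0"
    using pmap_weight_vector[OF t y(1)] pmap_scaled_weight_vector[OF t z(1,3,4)] by auto
  obtain a b where ab: "bracket z y = scale a z + scale b y"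
    using bracket_square_zero[OF pz py] .
  have "bracket t (bracket z y) = scale (r + 1) (bracket z y)"
    by (simp add: bracket_derivation[of t] z y bracket_simps scale_left_distrib)
  then have "scale a z + scale (r * b) y = 0"
    by (simp add: ab bracket_simps z y scale_right_distrib scale_left_distrib algebra_simps)
  then have 1: "scale a z = - scale (r * b) y" by (simp add: eq_neg_iff_add_eq_0)
  then have "bracket t (scale a z) = bracket t (- scale (r * b) y)" by simp
  then have "scale r (scale a z) = - scale (r * b) y"
    using z y by (simp add: bracket_simps mult.commute)
  with 1 have "scale r (scale a z) = scale a z" by metis
  then have "scale (r - 1) (scale a z) = 0"
    by (simp only: scale_left_diff_distrib scale_one) simp
  then have "a = 0" using \<open>r \<noteq> 1\<close> z by simp
  moreover from this 1 have "b = 0" using z y by simp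
  ultimately have "bracket z y = 0" using ab by simp
  then show False
    using commuting_with_weight_vector[OF t y z(1) pz] \<open>r \<noteq> 1\<close> z(2) by blast
qed

section \<open>Weight space decomposition for a toral element\<close>

context
  fixes t y
  assumes t: "pmap t = t" and y: "bracket t y = y" "y \<noteq> 0"
begin

definition "zero_part = {h. bracket t h = 0}"
definition "one_part = {n. bracket t n = n}"

lemma subspace_parts: "subspace zero_part" "subspace one_part"
  by (auto simp: subspace_def zero_part_def one_part_def bracket_simps)

lemma bracket_parts:
  "h \<in> zero_part \<Longrightarrow> n \<in> one_part \<Longrightarrow> bracket h n \<in> one_part"
  "h \<in> zero_part \<Longrightarrow> g \<in> zero_part \<Longrightarrow> bracket h g \<in> zero_part"
  by (simp_all add: zero_part_def one_part_def bracket_derivation[of t])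

lemma restricted_subalgebra_zero_part: "restricted_subalgebra zero_part"
proof -
  have "bracket t (pmap h) = 0" if "bracket t h = 0" for h
    using that bracket_pmap_power_commuting[of h t 1] bracket_eq_0_swap by simp
  then show ?thesis
    using subspace_parts bracket_parts
    by (auto simp: restricted_subalgebra_def subalgebra_def) (simp add: zero_part_def)
qed

lemma pmap_one_part: "n \<in> one_part \<Longrightarrow> pmap n = 0"
  using pmap_weight_vector[OF t] by (simp add: one_part_def)

text \<open>The bracket has weight 2, yet lies in the span of \<open>m\<close> and \<open>n\<close>,
  hence has weight 1.\<close>

lemma one_part_abelian:
  assumes "m \<in> one_part" "n \<in> one_part"
  shows "bracket m n = 0"
proof -
  obtain a b where ab: "bracket m n = scale a m + scale b n"
    using bracket_square_zero[OF pmap_one_part pmap_one_part] assms by metis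
  have "bracket t (bracket m n) = bracket m n + bracket m n"
    using assms by (simp add: one_part_def bracket_derivation[of t])
  moreover have "bracket t (bracket m n) = bracket m n"
    using assms by (simp add: ab one_part_def bracket_simps)
  ultimately show ?thesis by simp
qed

lemma parts_disjoint: "zero_part \<inter> one_part = {0}"
  by (auto simp: zero_part_def one_part_def)

text \<open>\<open>ad t\<close> is a root of \<open>X\<^sup>p - X\<close>, and the roots of \<open>(X\<^sup>p - X) / (X\<^sup>2 - X)\<close> are not eigenvalues.\<close>
lemma one_part_image:
  assumes k: "CHAR('k) = Suc (Suc k)"
  shows "(bracket t ^^ Suc k) v \<in> one_part"
proof -
  define D where "D = bracket t"
  have D: "(D ^^ n) (x - z) = (D ^^ n) x - (D ^^ n) z" for n x z
    by (induction n) (simp_all add: D_def bracket_simps)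
  have Dp: "(D ^^ Suc (Suc k)) x = D x" for x
    using bracket_pmap[of t x] t by (simp add: D_def k)
  have hom: "module_hom scale scale D"
    using linear_right[of t] by (simp add: module_hom_iff_linear D_def)
  define u where "u = (D ^^ Suc k) v"
  have u: "(D ^^ Suc k) u = u"
  proof -
    have "(D ^^ Suc k) u = (D ^^ k) ((D ^^ Suc (Suc k)) v)"
      by (simp add: u_def funpow_swap1)
    also have "\<dots> = u" unfolding Dp by (simp add: u_def funpow_swap1)
    finally show ?thesis .
  qed
  \<comment> \<open>As \<open>k = p - 2\<close>, this is \<open>(X^(p-1) - 1) / (X - 1)\<close>. It
    kills \<open>D u - u\<close> by telescoping, because \<open>D^(p-1) u = u\<close>.\<close>
  define q :: "'k poly" where "q = (\<Sum>i<Suc k. monom 1 i)"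
  have pow: "poly_act scale D (monom 1 n) x = (D ^^ n) x" for n x
    by (induction n arbitrary: x) (simp_all add: monom_0 monom_Suc funpow_swap1)
  have "poly_act scale D (\<Sum>i<n. monom 1 i) (D u - u) = (D ^^ n) u - u" for n
    by (induction n) (simp_all add: poly_act_add pow D funpow_swap1)
  then have q0: "poly_act scale D q (D u - u) = 0" using u unfolding q_def by (simp only: diff_self)
  \<comment> \<open>The values are 1 and \<open>p - 1 = -1\<close>, so a root of \<open>q\<close>
    that is an eigenvalue would be a forbidden weight.\<close>
  have q_roots: "poly q 0 \<noteq> 0" "poly q 1 \<noteq> 0"
  proof -
    have "poly q 0 = 1"
      by (simp add: q_def poly_sum poly_monom sum.lessThan_Suc_shift del: sum.lessThan_Suc)
    then show "poly q 0 \<noteq> 0" by simp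
    have "poly q 1 + 1 = of_nat (Suc (Suc k))"
      by (simp add: q_def poly_sum poly_monom)
    also have "\<dots> = 0" by (simp only: k[symmetric] of_nat_CHAR)
    finally show "poly q 1 \<noteq> 0" by auto
  qed
  have "D u = u"
  proof (rule ccontr)
    assume "D u \<noteq> u"
    have "q \<noteq> 0" using q_roots by auto
    then have "\<exists>c w. poly q c = 0 \<and> w \<in> UNIV \<and> w \<noteq> 0 \<and> D w = scale c w"
      using alg_closed_imp_poly_has_root \<open>D u \<noteq> u\<close>
      by (intro eigenvector_of_annihilator[OF hom _ q0]) auto
    then obtain c w where cw: "poly q c = 0" "w \<noteq> 0" "D w = scale c w" by blast
    have "(D ^^ n) w = scale (c ^ n) w" for n
      by (induction n) (simp_all add: cw D_def[symmetric] bracket_scale_right[of t, folded D_def] mult.commute)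
    then have "c ^ CHAR('k) = c" using Dp[of w] cw by (simp add: k del: funpow.simps)
    then show False
      using toral_weight_unique[OF t y cw(3,2)[unfolded D_def]] cw(1) q_roots by auto
  qed
  then show ?thesis by (simp only: one_part_def u_def D_def mem_Collect_eq)
qed

text \<open>The projection onto \<open>one_part\<close> is \<open>(ad t)^(p-1)\<close>: from
  \<open>(ad t)^p = ad t\<close>, the remainder is killed by \<open>ad t\<close>.\<close>

lemma parts_span: "zero_part + one_part = UNIV"
proof -
  obtain k where k: "CHAR('k) = Suc (Suc k)"
    using char_ge_2 by (metis add_2_eq_Suc le_Suc_ex)
  have "v \<in> zero_part + one_part" for v
  proof -
    define u where "u = (bracket t ^^ Suc k) v"
    have u: "u \<in> one_part" unfolding u_def by (rule one_part_image[OF k])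
    moreover have "bracket t u = bracket t v"
      using bracket_pmap[of t v] t by (simp add: k u_def)
    then have "v - u \<in> zero_part" by (simp add: zero_part_def bracket_simps)
    ultimately show ?thesis by (metis diff_add_cancel set_plus_intro)
  qed
  then show ?thesis by blast
qed

text \<open>Comparing weights, \<open>[h, y] = b y\<close>. As
  \<open>(ad h)^p = ad (pmap h) = 0\<close>, the eigenvalue \<open>b\<close> is 0, so
  \<open>h\<close> commutes with \<open>y\<close> and has weight 0, not 1.\<close>

lemma pmap_injective_zero_part:
  assumes h: "h \<in> zero_part" "pmap h = 0"
  shows "h = 0"
proof -
  have th: "bracket t h = 0" using h by (simp add: zero_part_def)
  have "y \<in> one_part" using y by (simp add: one_part_def)
  obtain a b where ab: "bracket h y = scale a h + scale b y"
    using bracket_square_zero[OF h(2) pmap_one_part[OF \<open>y \<in> one_part\<close>]] .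
  have "bracket t (bracket h y) = bracket h y"
    using bracket_parts(1)[OF h(1) \<open>y \<in> one_part\<close>] by (simp add: one_part_def)
  then have hy: "bracket h y = scale b y"
    by (simp add: ab bracket_simps th y)
  have "(bracket h ^^ n) y = scale (b ^ n) y" for n
    by (induction n) (simp_all add: hy bracket_simps mult.commute)
  then have "b = 0" using bracket_pmap[of h y] h y by simp
  then show ?thesis
    using commuting_with_weight_vector[OF t y, of h 0] th h hy by simp
qed

lemma zero_part_semisimple:
  assumes "h \<in> zero_part"
  shows "h \<in> cyclic (pmap h)"
proof (rule semisimple_if_pmap_injective)
  fix z assume "z \<in> cyclic h" "pmap z = 0"
  then show "z = 0"
    using cyclic_minimal[OF restricted_subalgebra_zero_part assms] pmap_injective_zero_part by auto
qed

text \<open>Semisimplicity of \<open>h\<close> makes the kernels of \<open>(ad h)^2\<close> and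
  \<open>ad h\<close> equal. A nonzero bracket would therefore give an eigenvector \<open>w\<close>
  in \<open>zero_part\<close> with nonzero eigenvalue; it has weight 1 for some toral
  \<open>s\<close>, so \<open>pmap w = 0\<close>, contradicting injectivity.\<close>

lemma zero_part_abelian:
  assumes h: "h \<in> zero_part" and g: "g \<in> zero_part"
  shows "bracket h g = 0"
proof (rule ccontr)
  assume nz: "bracket h g \<noteq> 0"
  have *: "bracket h x = 0" if "bracket h (bracket h x) = 0" for x
  proof -
    have "bracket (pmap h) x = 0"
      using that char_ge_2 by (intro bracket_pmap_eq_0[where n = 2]) (auto simp: numeral_2_eq_2)
    then show ?thesis using bracket_cyclic zero_part_semisimple[OF h] by blast
  qed
  have "(bracket h ^^ Suc n) g \<noteq> 0" for n
  proof (induction n)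
    case (Suc n)
    then show ?case using *[of "(bracket h ^^ n) g"] by auto
  qed (use nz in simp)
  then have "(bracket h ^^ n) g \<noteq> 0" for n by (cases n) (use nz in auto)
  then obtain w c where w: "w \<in> zero_part" "w \<noteq> 0" "c \<noteq> 0" "bracket h w = scale c w"
    using nonzero_eigenvector[OF _ g subspace_parts(1)] bracket_parts(2)[OF h] by metis
  then have "bracket (scale (1 / c) h) w = w" by (simp add: bracket_simps)
  then obtain s where "pmap s = s" "bracket s w = w" using toral_element by metis
  then show False using pmap_weight_vector pmap_injective_zero_part w by blast
qed

end

subsection \<open>The ad-nilpotent case\<close>

context
  assumes ad_nilpotent: "\<And>x y. \<exists>n. (bracket x ^^ n) y = 0"
begin

lemma ad_uniformly_nilpotent: "\<exists>n. \<forall>y. (bracket x ^^ n) y = 0"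
proof -
  have mono: "(bracket x ^^ n) y = 0 \<Longrightarrow> (bracket x ^^ m) y = 0" if "n \<le> m" for n m y
    using that by (induction rule: dec_induct) simp_all
  have "\<exists>n. \<forall>m\<ge>n. {y. (bracket x ^^ m) y = 0} = {y. (bracket x ^^ n) y = 0}"
    by (rule ascending_stable) (auto simp: subspace_def ad_power_linear)
  then obtain n where n: "\<And>m. m \<ge> n \<Longrightarrow> {y. (bracket x ^^ m) y = 0} = {y. (bracket x ^^ n) y = 0}"
    by blast
  have "(bracket x ^^ n) y = 0" for y
  proof -
    obtain m where "(bracket x ^^ m) y = 0" using ad_nilpotent by blast
    then have "(bracket x ^^ max m n) y = 0" using mono[of m "max m n"] by simp
    then show ?thesis using n[of "max m n"] by auto
  qed
  then show ?thesis by blast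
qed

text \<open>\<open>ad (pmap^n x)\<close> is the \<open>p^n\<close>-th power of \<open>ad x\<close>,
  and \<open>p^n \<ge> n\<close>.\<close>

lemma pmap_power_central: "\<exists>n. \<forall>y. bracket ((pmap ^^ n) x) y = 0"
proof -
  obtain n where n: "\<And>y. (bracket x ^^ n) y = 0" using ad_uniformly_nilpotent by blast
  have "n \<le> CHAR('k) ^ n"
    using char_ge_2 by (intro less_imp_le power_gt_expt) auto
  then have "(bracket x ^^ (CHAR('k) ^ n)) y = 0" for y
    using n by (metis funpow_add le_add_diff_inverse o_apply)
  then show ?thesis using bracket_pmap_power by metis
qed

lemma bracket_in_pmap_span:
  obtains u v where "bracket x y = u + v" "u \<in> cyclic (pmap x)" "v \<in> cyclic (pmap y)"
proof -
  define B where "B = cyclic (pmap x) + cyclic (pmap y)"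
  have B: "restricted_subalgebra B"
    unfolding B_def by (intro restricted_subalgebra_sum restricted_subalgebra_cyclic)
  then have subB: "subspace B" by (simp add: restricted_subalgebra_def subalgebra_def)
  \<comment> \<open>The quasi-ideal property puts \<open>[b, z]\<close> into \<open>B\<close> plus
    the line through \<open>z\<close>; nilpotency of \<open>ad b\<close> removes the multiple of
    \<open>z\<close>.\<close>
  have B_stable: "bracket z b \<in> B" if z: "cyclic (pmap z) \<subseteq> B" and b: "b \<in> B" for z b
  proof -
    obtain b' v where bz: "bracket b z = b' + v" "b' \<in> B" "v \<in> cyclic z"
      using bracket_in_plus[OF B restricted_subalgebra_cyclic b self_in_cyclic] .
    obtain c w where cw: "w \<in> cyclic (pmap z)" "v = scale c z + w"
      using bz(3) by (rule cyclicE)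
    have mem: "b' + w \<in> B" using bz cw z subB by (auto intro: subspace_add)
    obtain n where "(bracket b ^^ n) z = 0" using ad_nilpotent by blast
    moreover have "bracket b z - scale c z \<in> B" using mem bz cw by (simp add: algebra_simps)
    ultimately have "scale c z \<in> B"
      using B b by (intro nilpotent_eigenvalue_mod[OF subB, of b])
        (auto simp: restricted_subalgebra_def subalgebra_def)
    then have "scale c z + (b' + w) \<in> B" using subspace_add[OF subB _ mem] by blast
    then have "bracket b z \<in> B" using bz cw by (simp add: algebra_simps)
    then show ?thesis using subB bracket_swap[of z b] by (simp add: subspace_neg)
  qed
  have xB: "cyclic (pmap x) \<subseteq> B" and yB: "cyclic (pmap y) \<subseteq> B"
    unfolding B_def by (simp_all add: subset_plus_left subset_plus_right)
  obtain u v where uv: "bracket x y = u + v" "u \<in> cyclic x" "v \<in> cyclic y"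
    using bracket_cyclicE .
  obtain a u' where u': "u' \<in> cyclic (pmap x)" "u = scale a x + u'" using uv(2) by (rule cyclicE)
  obtain c v' where v': "v' \<in> cyclic (pmap y)" "v = scale c y + v'" using uv(3) by (rule cyclicE)
  define w where "w = scale a x + scale c y"
  have b: "bracket x y - w \<in> B"
    using uv u' v' xB yB subB by (auto simp: w_def intro: subspace_add)
  \<comment> \<open>Modulo \<open>B\<close>, \<open>[x, y] = w = a x + c y\<close>, so
    \<open>ad x\<close> has \<open>w\<close> as eigenvector with eigenvalue \<open>c\<close>. If
    \<open>c = 0\<close>, then \<open>x\<close> is one for \<open>ad y\<close> with eigenvalue
    \<open>-a\<close>.\<close>
  have "w \<in> B"
  proof (cases "c = 0")
    case False
    obtain n where n: "(bracket x ^^ n) w = 0" using ad_nilpotent by blast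
    have "scale c (bracket x y - w) \<in> B" using b subB by (intro subspace_scale)
    then have "bracket x w - scale c w \<in> B"
      by (simp add: w_def bracket_simps algebra_simps)
    then have "scale c w \<in> B"
      by (rule nilpotent_eigenvalue_mod[OF subB B_stable[OF xB], rotated, OF _ n])
    then have "scale (1 / c) (scale c w) \<in> B" by (rule subspace_scale[OF subB])
    then show ?thesis using False by simp
  next
    case True
    obtain n where n: "(bracket y ^^ n) x = 0" using ad_nilpotent by blast
    have "- (bracket x y - w) \<in> B" using b subB by (intro subspace_neg)
    then have "bracket y x - scale (- a) x \<in> B"
      using True bracket_swap[of y x] by (simp add: w_def)
    then have "scale (- a) x \<in> B"
      by (rule nilpotent_eigenvalue_mod[OF subB B_stable[OF yB], rotated, OF _ n])
    then have "- scale (- a) x \<in> B" using subB by (intro subspace_neg)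
    then show ?thesis using True by (simp add: w_def)
  qed
  then have "bracket x y - w + w \<in> B" using b subB by (intro subspace_add)
  then have "bracket x y \<in> B" by simp
  then show ?thesis using that unfolding B_def by (auto elim!: set_plus_elim)
qed

lemma restricted_subalgebra_centre: "restricted_subalgebra (centre UNIV)"
proof -
  have "bracket (pmap x) y = 0" if "\<And>y. bracket x y = 0" for x y
    using that bracket_pmap_power_commuting[of x y 1] by simp
  then show ?thesis
    by (auto simp: restricted_subalgebra_def subalgebra_def subspace_def centre_def bracket_simps)
qed

text \<open>Engel's theorem. The flag of subalgebras it needs, each of codimension one and an ideal in the
  next, starts at the centre and comes from the quasi-ideal property.\<close>
lemma engel:
  assumes W: "subspace W" "\<And>x w. w \<in> W \<Longrightarrow> bracket x w \<in> W" and "W \<noteq> UNIV"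
  obtains z where "z \<notin> W" "\<And>x. bracket x z \<in> W"
proof -
  define Q where "Q S \<longleftrightarrow> restricted_subalgebra S \<and> centre UNIV \<subseteq> S \<and>
    (\<exists>z. z \<notin> W \<and> (\<forall>s\<in>S. bracket s z \<in> W))" for S
  have "Q (centre UNIV)"
    using assms(3) W(1) restricted_subalgebra_centre by (auto simp: Q_def centre_def subspace_0)
  moreover have "\<forall>S. Q S \<longrightarrow> dim S < Suc dimension"
    using dim_subset_UNIV by (auto simp: less_Suc_eq_le)
  ultimately obtain S where "Q S" and S_max: "\<And>S'. Q S' \<Longrightarrow> dim S' \<le> dim S"
    using ex_has_greatest_nat[of Q "centre UNIV" dim "Suc dimension"] by blast
  then obtain z where S: "restricted_subalgebra S" "centre UNIV \<subseteq> S"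
    and z: "z \<notin> W" "\<And>s. s \<in> S \<Longrightarrow> bracket s z \<in> W"
    by (auto simp: Q_def)
  have subS: "subspace S" using S by (simp add: restricted_subalgebra_def subalgebra_def)
  have "S = UNIV"
  proof (rule ccontr)
    assume "S \<noteq> UNIV"
    then obtain x0 where "x0 \<notin> S" by blast
    \<comment> \<open>High \<open>pmap\<close> iterates are central, hence in \<open>S\<close>. The
      last iterate outside \<open>S\<close> is the \<open>x\<close> by which \<open>S\<close> grows
      by exactly one dimension.\<close>
    have "\<exists>n. (pmap ^^ n) x0 \<in> S"
      using pmap_power_central[of x0] S(2) by (auto simp: centre_def)
    then obtain n where n: "(pmap ^^ n) x0 \<in> S" "\<And>m. m < n \<Longrightarrow> (pmap ^^ m) x0 \<notin> S"
      using exists_least_iff[of "\<lambda>n. (pmap ^^ n) x0 \<in> S"] by blast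
    then obtain m where m: "n = Suc m" using \<open>x0 \<notin> S\<close> by (cases n) auto
    define x where "x = (pmap ^^ m) x0"
    have x: "x \<notin> S" "pmap x \<in> S" using n m by (auto simp: x_def)
    have cyc: "cyclic (pmap x) \<subseteq> S" using cyclic_minimal[OF S(1) x(2)] .
    define S' where "S' = S + cyclic x"
    have S': "restricted_subalgebra S'"
      unfolding S'_def by (intro restricted_subalgebra_sum restricted_subalgebra_cyclic S)
    have S'E: "\<exists>c s. u = scale c x + s \<and> s \<in> S" if "u \<in> S'" for u
    proof -
      from that obtain s v where u: "u = s + v" "s \<in> S" "v \<in> cyclic x"
        by (auto simp: S'_def elim!: set_plus_elim)
      obtain c w where "w \<in> cyclic (pmap x)" "v = scale c x + w" using u(3) by (rule cyclicE)
      then have "u = scale c x + (s + w)" "s + w \<in> S"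
        using u cyc subS by (auto simp: algebra_simps intro: subspace_add)
      then show ?thesis by blast
    qed
    have Sx: "bracket s x \<in> S" if s: "s \<in> S" for s
    proof -
      obtain s' v where *: "bracket s x = s' + v" "s' \<in> S" "v \<in> cyclic x"
        using bracket_in_plus[OF S(1) restricted_subalgebra_cyclic s self_in_cyclic] .
      then have "bracket s x \<in> S'" by (auto simp: S'_def intro: set_plus_intro)
      then obtain c w where cw: "bracket s x = scale c x + w" "w \<in> S" using S'E by blast
      obtain n where "(bracket s ^^ n) x = 0" using ad_nilpotent by blast
      then have "scale c x \<in> S"
        using S(1) s cw by (intro nilpotent_eigenvalue_mod[OF subS, of s])
          (auto simp: restricted_subalgebra_def subalgebra_def)
      then show ?thesis using cw subS by (simp add: subspace_add)
    qed
    have iter: "bracket s ((bracket x ^^ n) z) \<in> W" if "s \<in> S" for s n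
      using that
    proof (induction n arbitrary: s)
      case (Suc n)
      have "bracket s ((bracket x ^^ Suc n) z)
          = bracket (bracket s x) ((bracket x ^^ n) z) + bracket x (bracket s ((bracket x ^^ n) z))"
        by (simp add: bracket_derivation[of s x])
      then show ?case using Suc W Sx by (simp add: subspace_add)
    qed (use z in simp)
    have "\<exists>n. (bracket x ^^ n) z \<in> W"
      using ad_nilpotent[of x z] W(1) subspace_0 by metis
    then obtain n where n: "(bracket x ^^ n) z \<in> W" "\<And>m. m < n \<Longrightarrow> (bracket x ^^ m) z \<notin> W"
      using exists_least_iff[of "\<lambda>n. (bracket x ^^ n) z \<in> W"] by blast
    then obtain m where m: "n = Suc m" using z(1) by (cases n) auto
    \<comment> \<open>The last iterate of \<open>ad x\<close> on \<open>z\<close> outside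
      \<open>W\<close>: \<open>x\<close> sends it into \<open>W\<close>, and by \<open>iter\<close>
      so does \<open>S\<close>. Thus \<open>S'\<close> contradicts the maximality of
      \<open>S\<close>.\<close>
    define z' where "z' = (bracket x ^^ m) z"
    have z': "z' \<notin> W" "bracket x z' \<in> W" using n m by (auto simp: z'_def)
    have "bracket u z' \<in> W" if u: "u \<in> S'" for u
    proof -
      obtain c s where "u = scale c x + s" "s \<in> S" using S'E[OF u] by blast
      then show ?thesis using z'(2) iter W(1)
        by (simp add: z'_def bracket_simps subspace_add subspace_scale)
    qed
    moreover have SS': "S \<subseteq> S'" "x \<in> S'"
      using subset_plus_left[of "cyclic x" S] subset_plus_right[OF subS, of "cyclic x"]
    by (auto simp: S'_def)
    ultimately have "Q S'" using S' S(2) z'(1) by (auto simp: Q_def)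
    then have "dim S' \<le> dim S" by (rule S_max)
    then have "S = S'"
      using S' SS' subS by (intro subspace_dim_equal) (auto simp: restricted_subalgebra_def subalgebra_def)
    then show False using SS' x by simp
  qed
  then show ?thesis using that z by blast
qed

text \<open>\<open>W\<close> is the second term of the upper central series. Were it proper,
  \<open>engel\<close> would supply an \<open>x\<close> outside it in the third term, and the triple
  brackets \<open>x3\<close> would vanish.\<close>

lemma nilpotency_class_2: "bracket a (bracket b c) = 0"
proof -
  define W where "W = {x. \<forall>y z. bracket z (bracket y x) = 0}"
  have W: "subspace W" "\<And>x w. w \<in> W \<Longrightarrow> bracket x w \<in> W"
    by (auto simp: W_def subspace_def bracket_simps)
  have "W = UNIV"
  proof (rule ccontr)
    assume "W \<noteq> UNIV"
    then obtain x where x: "x \<notin> W" and *: "\<And>y. bracket y x \<in> W" using engel[OF W] by metis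
    then have x3: "bracket u (bracket v (bracket w x)) = 0" for u v w by (simp add: W_def)
    have comm: "bracket v x = 0" if "v \<in> cyclic (pmap y)" for v y
    proof -
      have "bracket (pmap y) x = 0"
        using char_ge_3 x3 by (intro bracket_pmap_eq_0[where n = 3]) (auto simp: numeral_3_eq_3)
      then show ?thesis using that by (rule bracket_cyclic)
    qed
    have central: "bracket v y = 0" if "v \<in> cyclic (pmap x)" for v y
    proof -
      have "bracket (pmap x) y = 0"
        using char_ge_3 x3 bracket_swap[of x y]
        by (intro bracket_pmap_eq_0[where n = 3]) (auto simp: numeral_3_eq_3 bracket_minus_right)
      then show ?thesis using that by (rule bracket_cyclic)
    qed
    \<comment> \<open>In \<open>[x, y] = u + v\<close>, the summand \<open>u\<close> is central and
      \<open>v\<close> lies in \<open>cyclic y\<close>.\<close>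
    have yy: "bracket y (bracket x y) = 0" for y
    proof -
      obtain u v where uv: "bracket x y = u + v" "u \<in> cyclic (pmap x)" "v \<in> cyclic (pmap y)"
        using bracket_in_pmap_span .
      have "bracket u y = 0" using uv central by blast
      moreover have "bracket v y = 0"
        using uv(3) cyclic_pmap_subset cyclic_abelian self_in_cyclic by blast
      ultimately show ?thesis using uv by (simp add: bracket_add_right bracket_eq_0_swap)
    qed
    have "bracket w (bracket y x) = 0" for y w
    proof -
      \<comment> \<open>Polarisation of \<open>yy\<close>; the Jacobi identity, with
        \<open>[x, [y, w]] = 0\<close> by \<open>comm\<close>, gives the same relation with one sign
        reversed.\<close>
      have "bracket (y + w) (bracket x (y + w)) = 0" by (rule yy)
      then have 1: "bracket y (bracket x w) + bracket w (bracket x y) = 0"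
        by (simp add: bracket_simps yy add.commute)
      have "bracket x (bracket y w) = 0"
      proof -
        obtain u v where uv: "bracket y w = u + v" "u \<in> cyclic (pmap y)" "v \<in> cyclic (pmap w)"
          using bracket_in_pmap_span .
        then show ?thesis using comm by (simp add: bracket_add_right bracket_eq_0_swap)
      qed
      then have 2: "bracket y (bracket w x) + bracket w (bracket x y) = 0"
        using jacobi[of x y w] by simp
      have "bracket y (bracket x w) = - bracket y (bracket w x)"
        by (subst bracket_swap) (simp add: bracket_minus_right)
      with 1 2 have "bracket w (bracket x y) + bracket w (bracket x y) = 0"
        by (simp add: add_eq_0_iff)
      then have "scale 2 (bracket w (bracket x y)) = 0"
        by (metis one_add_one scale_left_distrib scale_one)
      then have "bracket w (bracket x y) = 0" using two_neq_0 by simp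
      then show ?thesis by (subst bracket_swap[of y]) (simp add: bracket_minus_right)
    qed
    then show False using x by (simp add: W_def)
  qed
  then show ?thesis by (auto simp: W_def)
qed

section \<open>Fitting decomposition of the semilinear \<open>p\<close>-map\<close>

lemma semilinear_on_UNIV: "semilinear_on UNIV"
  using pmap_add_class_2[OF nilpotency_class_2 char_neq_2] by (simp add: semilinear_on_def)

lemma pmap_central: "bracket (pmap x) y = 0"
  using char_ge_2 by (intro bracket_pmap_eq_0[where n = 2])
    (simp_all add: numeral_2_eq_2 nilpotency_class_2)

lemma lower_central_3_eq_0: "lower_central M 3 = {0}"
proof -
  have "brackets M M \<subseteq> {z. \<forall>y. bracket z y = 0}"
    unfolding brackets_def
    by (rule span_minimal)
      (auto simp: subspace_def bracket_simps bracket_eq_0_swap[OF nilpotency_class_2])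
  then show ?thesis unfolding lower_central_3 by (intro brackets_eq_0) auto
qed

text \<open>Kernels ascend and images descend, so both are stable from some \<open>n\<close> on.
  Equal kernels for \<open>n\<close> and \<open>2n\<close> make the intersection trivial; equal
  images make the sum everything.\<close>

lemma fitting_decomposition:
  obtains n where "n > 0" "\<And>x m. (pmap ^^ m) x = 0 \<Longrightarrow> (pmap ^^ n) x = 0"
    "vector_direct_sum UNIV (range (pmap ^^ n)) {x. (pmap ^^ n) x = 0}"
proof -
  let ?K = "\<lambda>n. {x. (pmap ^^ n) x = 0}" and ?I = "\<lambda>n. range (pmap ^^ n)"
  have subK: "subspace (?K n)" and subI: "subspace (?I n)" for n
    using subspace_pmap_power_image[OF semilinear_on_UNIV] pmap_power_add[OF semilinear_on_UNIV]
    by (auto simp: subspace_def pmap_power_scale)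
  have "\<exists>n. \<forall>m\<ge>n. ?K m = ?K n"
    by (rule ascending_stable) (use subK in auto)
  then obtain a where a: "\<And>m. m \<ge> a \<Longrightarrow> ?K m = ?K a" by blast
  have "\<exists>n. \<forall>m\<ge>n. ?I m = ?I n"
    by (rule descending_stable) (use subI in \<open>auto simp del: funpow.simps simp: funpow_Suc_right\<close>)
  then obtain b where b: "\<And>m. m \<ge> b \<Longrightarrow> ?I m = ?I b" by blast
  obtain n where n: "n > 0" "a \<le> n" "b \<le> n"
    by (metis max.cobounded1 max.cobounded2 le_SucI zero_less_Suc)
  have K: "?K m \<subseteq> ?K n" for m
  proof -
    have "(pmap ^^ (m + n)) x = 0" if "(pmap ^^ m) x = 0" for x
      using that by (simp add: add.commute[of m] funpow_add)
    then have "?K m \<subseteq> ?K (m + n)" by blast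
    also have "?K (m + n) = ?K n" using a[of "m + n"] a[of n] n by simp
    finally show ?thesis .
  qed
  have "(pmap ^^ n) x \<in> ?I (n + n)" for x
  proof -
    have "?I (n + n) = ?I n" using b[of "n + n"] b[of n] n by simp
    then show ?thesis by blast
  qed
  then have I: "\<exists>y. (pmap ^^ n) x = (pmap ^^ n) ((pmap ^^ n) y)" for x
    by (auto simp: funpow_add)
  have "?I n \<inter> ?K n = {0}"
  proof (intro equalityI subsetI)
    fix x assume "x \<in> ?I n \<inter> ?K n"
    then obtain y where y: "x = (pmap ^^ n) y" "(pmap ^^ n) x = 0" by auto
    then have "(pmap ^^ (n + n)) y = 0" by (simp add: funpow_add)
    then show "x \<in> {0}" using K[of "n + n"] y by auto
  qed (use subK subI in \<open>auto simp: subspace_0\<close>)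
  moreover have "x \<in> ?I n + ?K n" for x
  proof -
    obtain y where "(pmap ^^ n) x = (pmap ^^ n) ((pmap ^^ n) y)" using I by blast
    then have "x - (pmap ^^ n) y \<in> ?K n"
      by (simp add: pmap_power_diff[OF semilinear_on_UNIV])
    then have "(pmap ^^ n) y + (x - (pmap ^^ n) y) \<in> ?I n + ?K n" by (intro set_plus_intro) auto
    then show ?thesis by simp
  qed
  ultimately have "vector_direct_sum UNIV (?I n) (?K n)"
    using subI subK by (auto simp: vector_direct_sum_def)
  then show ?thesis using that[of n] K n by blast
qed

lemma decomposition_ad_nilpotent:
  "\<exists>S N. cartan_subalgebra UNIV \<and> algebra_direct_sum UNIV S N \<and> torus S \<and>
     N = {x \<in> UNIV. p_nilpotent x} \<and> vector_direct_sum UNIV S N \<and> ideal_of N UNIV \<and>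
     lower_central N 3 = {0} \<and> p_power N \<subseteq> centre UNIV"
proof -
  obtain n where n: "n > 0" "\<And>x m. (pmap ^^ m) x = 0 \<Longrightarrow> (pmap ^^ n) x = 0"
    and sum: "vector_direct_sum UNIV (range (pmap ^^ n)) {x. (pmap ^^ n) x = 0}"
    using fitting_decomposition by blast
  define S where "S = range (pmap ^^ n)"
  define N where "N = {x. (pmap ^^ n) x = 0}"
  have sub: "subspace S" "subspace N" and inter: "S \<inter> N = {0}" and span: "S + N = UNIV"
    using sum by (auto simp: vector_direct_sum_def S_def N_def)
  have S_central: "bracket s x = 0" if "s \<in> S" for s x
    using that n(1) pmap_central by (cases n) (auto simp: S_def)
  have pmap_S: "pmap s \<in> S" if "s \<in> S" for s
    using that by (auto simp: S_def funpow_swap1)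
  have pmap_N: "pmap x \<in> N" if "x \<in> N" for x
    using that by (simp add: N_def funpow_swap1[symmetric])
  have S: "restricted_subalgebra S"
    using sub pmap_S by (simp add: restricted_subalgebra_def subalgebra_def S_central subspace_0)
  have cyc_N: "cyclic x \<subseteq> N" if "x \<in> N" for x
  proof (rule cyclic_subset[OF sub(2)])
    show "(pmap ^^ i) x \<in> N" for i by (induction i) (use that pmap_N in auto)
  qed
  have "semisimple x" if "x \<in> S" for x
  proof -
    \<comment> \<open>The kernel of \<open>pmap\<close> lies in \<open>N\<close>, so
      \<open>pmap\<close> is injective on \<open>S\<close>.\<close>
    have "z = 0" if "z \<in> cyclic x" "pmap z = 0" for z
    proof -
      have "z \<in> N" using n(2)[of 1 z] that by (simp add: N_def)
      then show ?thesis using cyclic_minimal[OF S \<open>x \<in> S\<close>] that inter by auto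
    qed
    then show ?thesis
      by (simp add: semisimple_def generated_singleton semisimple_if_pmap_injective)
  qed
  then have torus: "torus S" using S S_central by (simp add: torus_def)
  have N: "ideal_of N UNIV"
  proof -
    \<comment> \<open>The \<open>S\<close>-component of \<open>y\<close> is central, and
      \<open>[x, z]\<close> lies in \<open>cyclic x + cyclic z\<close>, which is inside
      \<open>N\<close>.\<close>
    have "bracket x y \<in> N" if "x \<in> N" for x y
    proof -
      obtain s z where y: "y = s + z" "s \<in> S" "z \<in> N"
        using span by (metis UNIV_I set_plus_elim)
      then have "bracket x y = bracket x z"
        using S_central by (simp add: bracket_add_right bracket_eq_0_swap)
      moreover obtain u v where "bracket x z = u + v" "u \<in> cyclic x" "v \<in> cyclic z"
        using bracket_cyclicE .
      ultimately show ?thesis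
        using cyc_N[OF that] cyc_N[OF y(3)] sub(2) by (auto intro: subspace_add)
    qed
    then show ?thesis using sub by (simp add: ideal_of_def)
  qed
  have "ideal_of S UNIV"
    using sub by (simp add: ideal_of_def S_central subspace_0)
  then have "algebra_direct_sum UNIV S N"
    using N sum by (simp add: algebra_direct_sum_def S_def N_def)
  moreover have "N = {x \<in> UNIV. p_nilpotent x}"
    using n by (auto simp: N_def p_nilpotent_def)
  moreover have "cartan_subalgebra UNIV"
    using lower_central_3_eq_0
    by (auto simp: cartan_subalgebra_def subalgebra_def nilpotent_def normalizer_def)
  moreover have "p_power N \<subseteq> centre UNIV"
    unfolding p_power_def generated_def
    by (rule hull_minimal) (auto simp: centre_def pmap_central restricted_subalgebra_centre[unfolded centre_def, simplified])
  ultimately show ?thesis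
    using torus N sum lower_central_3_eq_0 unfolding S_def N_def by blast
qed

end

subsection \<open>The decomposition\<close>

lemma decomposition_toral:
  assumes t: "pmap t = t" and y: "bracket t y = y" "y \<noteq> 0"
  shows "cartan_subalgebra (zero_part t) \<and> algebra_direct_sum (zero_part t) (zero_part t) {0} \<and>
    torus (zero_part t) \<and> {0} = {x \<in> zero_part t. p_nilpotent x} \<and>
    vector_direct_sum UNIV (zero_part t) (one_part t) \<and> ideal_of (one_part t) UNIV \<and>
    lower_central (one_part t) 3 = {0} \<and> p_power (one_part t) \<subseteq> centre (zero_part t)"
proof -
  note parts = t y
  define H where "H = zero_part t"
  define N where "N = one_part t"
  have H: "restricted_subalgebra H"
    using restricted_subalgebra_zero_part[OF parts] by (simp add: H_def)
  have sub: "subspace H" "subspace N"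
    using subspace_parts[OF parts] by (simp_all add: H_def N_def)
  have H_abelian: "\<And>g h. g \<in> H \<Longrightarrow> h \<in> H \<Longrightarrow> bracket g h = 0"
    using zero_part_abelian[OF parts] by (simp add: H_def)
  have N_abelian: "\<And>m n. m \<in> N \<Longrightarrow> n \<in> N \<Longrightarrow> bracket m n = 0"
    using one_part_abelian[OF parts] by (simp add: N_def)
  have inter: "H \<inter> N = {0}" and span: "H + N = UNIV"
    using parts_disjoint[OF parts] parts_span[OF parts] by (simp_all add: H_def N_def)
  have HN: "bracket h n \<in> N" if "h \<in> H" "n \<in> N" for h n
    using bracket_parts(1)[OF parts] that by (simp add: H_def N_def)
  have "lower_central H 2 = {0}" "lower_central N 3 = {0}"
  proof -
    have "brackets H H = {0}" "brackets N N = {0}" "brackets {0} N = {0}"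
      by (rule brackets_eq_0; use H_abelian N_abelian in simp)+
    then show "lower_central H 2 = {0}" "lower_central N 3 = {0}"
      by (simp_all add: lower_central_2 lower_central_3)
  qed
  \<comment> \<open>Testing on \<open>t\<close> suffices: for \<open>x = h + n\<close> one gets
    \<open>[x, t] = -n\<close>, which lies in \<open>H\<close> only if \<open>n = 0\<close>.\<close>
  moreover have "normalizer H = H"
  proof (intro equalityI subsetI)
    fix x assume "x \<in> normalizer H"
    moreover have "t \<in> H" by (simp add: H_def zero_part_def[OF parts])
    ultimately have xt: "bracket x t \<in> H" by (simp add: normalizer_def)
    obtain h n where x: "x = h + n" "h \<in> H" "n \<in> N"
      using span by (metis UNIV_I set_plus_elim)
    have "bracket x t = - n"
      using x bracket_swap[of _ t]
      by (simp add: H_def N_def zero_part_def[OF parts] one_part_def[OF parts] bracket_simps)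
    then have "n \<in> H" using xt sub(1) subspace_neg by force
    then have "n = 0" using x(3) inter by blast
    then show "x \<in> H" using x(1,2) by simp
  qed (simp add: normalizer_def H_abelian sub subspace_0)
  ultimately have cartan: "cartan_subalgebra H"
    using H by (auto simp: cartan_subalgebra_def nilpotent_def restricted_subalgebra_def)
  have "x = 0" if "x \<in> H" "(pmap ^^ n) x = 0" for x n
    using that
  proof (induction n arbitrary: x)
    case (Suc n)
    then have "pmap x = 0"
      using H by (simp add: restricted_subalgebra_def funpow_swap1)
    then show ?case using Suc pmap_injective_zero_part[OF parts] by (simp add: H_def)
  qed simp
  then have P: "{0} = {x \<in> H. p_nilpotent x}"
    using sub by (auto simp: p_nilpotent_def subspace_0)
  have torus: "torus H"
    using H H_abelian zero_part_semisimple[OF parts]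
    by (simp add: torus_def semisimple_def generated_singleton H_def)
  have dir: "vector_direct_sum UNIV H N"
    using sub inter span by (simp add: vector_direct_sum_def)
  have adir: "algebra_direct_sum H H {0}"
    using sub H_abelian
    by (auto simp: algebra_direct_sum_def vector_direct_sum_def ideal_of_def subspace_0
        set_plus_def)
  have ideal: "ideal_of N UNIV"
  proof -
    have "bracket n x \<in> N" if "n \<in> N" for n x
    proof -
      obtain h m where x: "x = h + m" "h \<in> H" "m \<in> N"
        using span by (metis UNIV_I set_plus_elim)
      then have "bracket n x = - bracket h n"
        using N_abelian[OF that] bracket_swap[of n h] by (simp add: bracket_simps)
      then show ?thesis using HN[OF x(2) that] sub by (simp add: subspace_neg)
    qed
    then show ?thesis using sub by (simp add: ideal_of_def)
  qed
  have "p_power N \<subseteq> {0}"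
    unfolding p_power_def generated_def
    by (rule hull_minimal)
      (use pmap_one_part[OF parts] in \<open>auto simp: N_def restricted_subalgebra_def subalgebra_def\<close>)
  moreover have "0 \<in> centre H" using sub by (simp add: centre_def subspace_0)
  ultimately have "p_power N \<subseteq> centre H" by blast
  with cartan adir torus P dir ideal \<open>lower_central N 3 = {0}\<close> show ?thesis
    unfolding H_def N_def by blast
qed

theorem exists_decomposition:
  "\<exists>H S P N. cartan_subalgebra H \<and> algebra_direct_sum H S P \<and> torus S \<and>
     P = {x \<in> H. p_nilpotent x} \<and> vector_direct_sum UNIV S N \<and> ideal_of N UNIV \<and>
     lower_central N 3 = {0} \<and> p_power N \<subseteq> centre H"
proof (cases "\<forall>x y. \<exists>n. (bracket x ^^ n) y = 0")
  case True
  then show ?thesis using decomposition_ad_nilpotent by blast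
next
  case False
  then obtain x y0 where "\<And>n. (bracket x ^^ n) y0 \<noteq> 0" by blast
  then obtain y c where y: "y \<noteq> 0" "c \<noteq> 0" "bracket x y = scale c y"
    using nonzero_eigenvector[of x y0 UNIV] by auto
  then have "bracket (scale (1 / c) x) y = y" by (simp add: bracket_simps)
  then obtain t where "pmap t = t" "bracket t y = y" using toral_element by metis
  then show ?thesis using decomposition_toral y(1) by blast
qed

end

theorem corollary4p6:
  fixes scale :: "'k::alg_closed_field \<Rightarrow> 'a::ab_group_add \<Rightarrow> 'a"
    and bracket :: "'a \<Rightarrow> 'a \<Rightarrow> 'a"
    and pmap :: "'a \<Rightarrow> 'a"
  assumes "restricted_lie_algebra scale bracket pmap"
    and "\<exists>B. finite B \<and> module.span scale B = UNIV"
    and "CHAR('k) > 0" and "CHAR('k) \<noteq> 2"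
    and "\<And>S. restricted_lie_algebra.restricted_subalgebra scale bracket pmap S \<Longrightarrow>
           restricted_lie_algebra.restricted_quasi_ideal scale bracket pmap S"
  shows "\<exists>H S P N.
      lie_algebra.cartan_subalgebra scale bracket H \<and>
      lie_algebra.algebra_direct_sum scale bracket H S P \<and>
      restricted_lie_algebra.torus scale bracket pmap S \<and>
      P = {x \<in> H. restricted_lie_algebra.p_nilpotent pmap x} \<and>
      lie_algebra.vector_direct_sum scale UNIV S N \<and>
      lie_algebra.ideal_of scale bracket N UNIV \<and>
      lie_algebra.lower_central scale bracket N 3 = {0} \<and>
      restricted_lie_algebra.p_power scale bracket pmap N \<subseteq> lie_algebra.centre bracket H"
proof -
  interpret restricted_lie_algebra scale bracket pmap by (rule assms(1))
  obtain B where B: "finite B" "span B = UNIV" using assms(2) by blast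
  \<comment> \<open>The finite-dimensional locale asks for an independent spanning set, so the given
    one is thinned out.\<close>
  obtain Basis where Basis: "Basis \<subseteq> B" "independent Basis" "B \<subseteq> span Basis"
    using maximal_independent_subset by blast
  have "span Basis = UNIV"
    using B(2) span_minimal[OF Basis(3) subspace_span] by blast
  then interpret all_quasi_ideals scale bracket pmap Basis
    using B Basis assms by unfold_locales (auto intro: finite_subset)
  show ?thesis by (rule exists_decomposition)
qed

end
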